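(* Let $d\ge 1$, let $S\subset M_d(\mathbb{R})$ be a (nonempty) bounded set of matrices and let $\tau\ge 0$. Then $$\lambda^{\rm per}_\tau(S)=\lambda_\tau(S).$$
   Context: For a set $S$ of real $d\times d$ matrices and $\tau\ge 0$, $\mathcal{S}^\tau$ is the set of all functions $A:[0,T(A)]\to S$ (with $T(A)\ge 0$ depending on $A$) which are finite concatenations of $m\ge 1$ constant pieces, each defined on an interval of length at least $\tau$. $\mathcal{S}^\tau_\infty$ is the set of all piecewise constant functions $A:[0,+\infty)\to S$ for which there exists a sequence $T_n\to+\infty$ such that $A|_{[0,T_n]}\in\mathcal{S}^\tau$ for every $n$. For $A\in\mathcal{S}^\tau_\infty$, $t\mapsto\Phi_A(t,0)\in \mathrm{GL}(d,\mathbb{R})$ is the fundamental matrix of $\dot x(t)=A(t)x(t)$, i.e. $\frac{d}{dt}\Phi_A(t,0)=A(t)\Phi_A(t,0)$, $\Phi_A(0,0)=\mathrm{Id}_d$. The uniform exponential rate is $$\lambda_\tau(S)=\limsup_{t\to+\infty}\ \sup_{A\in\mathcal{S}^\tau_\infty}\frac{\log\|\Phi_A(t,0)\|}{t}.$$ Let $\pi:\mathbb{R}^d\setminus\{0\}\to\mathbb{RP}^{d-1}$ be the canonical projection. Let $\mathcal{S}_{\rm per}$ be the set of pairs $(A,x_0)\in\mathcal{S}^\tau_\infty\times(\mathbb{R}^d\setminus\{0\})$ for which there exists $T>0$ such that both $A(\cdot)$ and $t\mapsto\pi(\Phi_A(t,0)x_0)$ are $T$-periodic. Then $$\lambda^{\rm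 per}_\tau(S)=\sup_{(A,x_0)\in\mathcal{S}_{\rm per}}\ \limsup_{t\to+\infty}\frac{\log\|\Phi_A(t,0)x_0\|}{t}.$$ *)

theory Defs
  imports "HOL-Analysis.Analysis"
begin

(* A signal on [0,T] or [0,+oo) is a total function whose values outside that interval are
   irrelevant.  Concatenated pieces are constrained on the open intervals between consecutive
   switching times; at the switching times any value in S is allowed.  This has no influence on
   the flow, and it lets the restriction of a T-periodic signal to a union of pieces be a
   signal of the same class, whatever the one-sided continuity convention.  For tau = 0 pieces
   of length 0 are allowed. *)
definition signals_upto :: "(real^'n^'n) set \<Rightarrow> real \<Rightarrow> real \<Rightarrow> (real \<Rightarrow> real^'n^'n) set" where
  "signals_upto S \<tau> T = {A. A \<in> {0..T} \<rightarrow> S \<and>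
     (\<exists>(m::nat) (s::nat \<Rightarrow> real). 1 \<le> m \<and> s 0 = 0 \<and> s m = T \<and>
        (\<forall>i<m. \<tau> \<le> s (Suc i) - s i \<and> A constant_on {s i<..<s (Suc i)}))}"

(* Piecewise constancy on [0,+oo), i.e. finitely many pieces on each bounded interval, is
   implied by the condition on the restrictions to [0, T n]. *)
definition signals :: "(real^'n^'n) set \<Rightarrow> real \<Rightarrow> (real \<Rightarrow> real^'n^'n) set" where
  "signals S \<tau> = {A. A \<in> {0..} \<rightarrow> S \<and>
     (\<exists>T::nat \<Rightarrow> real. filterlim T at_top sequentially \<and> (\<forall>n. A \<in> signals_upto S \<tau> (T n)))}"

(* As A jumps, the equation is required off a locally finite set (the switching times);
   together with continuity this determines Phi on [0,+oo). *)
definition is_fundamental_matrix :: "(real \<Rightarrow> real^'n^'n) \<Rightarrow> (real \<Rightarrow> real^'n^'n) \<Rightarrow> bool" where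
  "is_fundamental_matrix A \<Phi> \<longleftrightarrow>
     \<Phi> 0 = mat 1 \<and> continuous_on {0..} \<Phi> \<and>
     (\<exists>D. (\<forall>T. finite (D \<inter> {0..T})) \<and>
        (\<forall>t\<in>{0..} - D. (\<Phi> has_vector_derivative A t ** \<Phi> t) (at t within {0..})))"

definition fundamental_matrix :: "(real \<Rightarrow> real^'n^'n) \<Rightarrow> real \<Rightarrow> real^'n^'n" where
  "fundamental_matrix A = (SOME \<Phi>. is_fundamental_matrix A \<Phi>)"

(* The canonical projection to real projective space, a point of which is a line through 0. *)
definition proj_line :: "real^'n \<Rightarrow> (real^'n) set" where
  "proj_line x = span {x}"

definition uniform_rate :: "real \<Rightarrow> (real^'n^'n) set \<Rightarrow> ereal" where
  "uniform_rate \<tau> S =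
     Limsup at_top (\<lambda>t::real. SUP A\<in>signals S \<tau>.
       ereal (ln (onorm ((*v) (fundamental_matrix A t))) / t))"

definition periodic_pairs ::
  "real \<Rightarrow> (real^'n^'n) set \<Rightarrow> ((real \<Rightarrow> real^'n^'n) \<times> (real^'n)) set" where
  "periodic_pairs \<tau> S = {(A, x0). A \<in> signals S \<tau> \<and> x0 \<noteq> 0 \<and>
     (\<exists>T>0. \<forall>t\<ge>0. A (t + T) = A t \<and>
        proj_line (fundamental_matrix A (t + T) *v x0) = proj_line (fundamental_matrix A t *v x0))}"

definition periodic_rate :: "real \<Rightarrow> (real^'n^'n) set \<Rightarrow> ereal" where
  "periodic_rate \<tau> S =
     (SUP (A, x0)\<in>periodic_pairs \<tau> S.
       Limsup at_top (\<lambda>t::real. ereal (ln (norm (fundamental_matrix A t *v x0)) / t)))"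

end

theory Submission
  imports Defs "HOL-Complex_Analysis.Complex_Analysis" "HOL-Real_Asymp.Real_Asymp"
    "Jordan_Normal_Form.Schur_Decomposition"
begin

text \<open>
A signal on a bounded interval is described by a word of pieces, and its flow is the corresponding
product of exponentials.  The periodic rate is at most the uniform rate because the norm of a vector
grows at most like the operator norm.  For the converse, fix a real number \<open>\<mu>\<close> above the periodic
rate; two facts show that the uniform rate is at most \<open>\<mu>\<close>.

The first is a Berger-Wang argument: if for every word the flow over its duration \<open>T\<close> has spectral
radius at most \<open>exp (\<mu> T)\<close>, then the norms of all flows are at most a polynomial in \<open>T\<close> times
\<open>exp (\<mu> T)\<close>.  After rescaling, all spectral radii are at most \<open>1\<close>, so all traces are bounded by
the dimension.  The flows span an algebra.  Modulo the radical of its trace form they are determined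
by boundedly many bounded traces, so they form a bounded set; the radical is a nil ideal and
therefore acts nilpotently.  This makes the flows block triangular with bounded diagonal blocks, and
products of \<open>n\<close> such matrices from a bounded set grow polynomially in \<open>n\<close>
(\<open>polynomial_growth_of_products\<close>, \<open>flow_growth\<close>).

The second removes the angle of the dominant eigenvalue.  Suppose that some word has an eigenvalue of
modulus larger than \<open>exp (\<mu> T)\<close>.  A periodic pair needs a real eigenvector, so some power of the
eigenvalue should be real.  Stretch all pieces of the word by a common factor \<open>s\<close> slightly larger
than \<open>1\<close>, which respects the dwell time.  On some interval of factors there is a continuous branch of
large eigenvalues.  If its angle varies, it passes through a rational multiple of \<open>\<pi>\<close>.  If its angle
is constant, say \<open>r u\<close> with \<open>u\<close> fixed, then conjugate eigenvalues have the constant quotient \<open>u\<^sup>2\<close>, so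
the Sylvester operator \<open>X \<mapsto> F X - u\<^sup>2 X F\<close> of the flow \<open>F\<close> is singular on an interval of factors.  Its
determinant is analytic in \<open>s\<close>, hence zero for \<open>s = 0\<close>, where \<open>F\<close> is the identity; so \<open>u\<^sup>2 = 1\<close> and
the eigenvalue is already real (\<open>constant_angle_is_real\<close>, \<open>eigenvalue_with_real_power\<close>).  Repeating
the stretched word then gives a periodic pair with rate larger than \<open>\<mu>\<close> (\<open>periodic_rate_ge\<close>), which is
impossible.
\<close>

hide_const (open) Matrix.mat Matrix.vec Matrix.row Matrix.transpose_mat Matrix.orthogonal
  Determinant.det Char_Poly.eigenvector Char_Poly.eigenvalue Char_Poly.char_poly VectorSpace.subspace
hide_fact (open) Matrix.orthogonal_def
hide_type (open) Matrix.vec Matrix.mat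
no_notation Matrix.vec_index (infixl "$" 100)
no_notation fps_nth (infixl "$" 75)

section \<open>Complex eigenvalues of real matrices\<close>

primrec mpow :: "real^'n^'n \<Rightarrow> nat \<Rightarrow> real^'n^'n" where
  "mpow A 0 = mat 1"
| "mpow A (Suc k) = mpow A k ** A"

definition cmat :: "real^'n^'n \<Rightarrow> complex^'n^'n" where
  "cmat A = (\<chi> i j. of_real (A $ i $ j))"

text \<open>Triangularisation over the complex numbers is carried out for matrices with index set
\<open>{0..<n}\<close>; this arbitrary enumeration of the index type transports it to matrices indexed by a
finite type.\<close>

definition enum :: "nat \<Rightarrow> 'n::finite" where
  "enum = (SOME f. bij_betw f {0..<CARD('n)} UNIV)"

lemma bij_enum: "bij_betw (enum :: nat \<Rightarrow> 'n::finite) {0..<CARD('n)} UNIV"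
  unfolding enum_def using someI_ex[OF ex_bij_betw_nat_finite[OF finite, of "UNIV :: 'n set"]] .

lemma sum_enum: "(\<Sum>i = 0..<CARD('n). f (enum i :: 'n::finite)) = (\<Sum>i\<in>UNIV. f i)"
  using sum.reindex_bij_betw[OF bij_enum] .

definition jnf_mat :: "real^'n^'n \<Rightarrow> complex Matrix.mat" where
  "jnf_mat A = Matrix.mat CARD('n) CARD('n) (\<lambda>(i, j). of_real (A $ enum i $ enum j))"

lemma jnf_mat_carrier [simp]: "jnf_mat (A :: real^'n^'n) \<in> carrier_mat CARD('n) CARD('n)"
  by (simp add: jnf_mat_def)

lemma jnf_mat_dim [simp]: "dim_row (jnf_mat (A :: real^'n^'n)) = CARD('n)"
  "dim_col (jnf_mat (A :: real^'n^'n)) = CARD('n)"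
  by (simp_all add: jnf_mat_def)

lemma jnf_mat_mult: "jnf_mat (A ** B) = jnf_mat A * jnf_mat (B :: real^'n^'n)"
  by (rule eq_matI)
    (auto simp: jnf_mat_def matrix_matrix_mult_def scalar_prod_def simp flip: sum_enum)

lemma jnf_mat_one: "jnf_mat (mat 1 :: real^'n^'n) = 1\<^sub>m CARD('n)"
proof (rule eq_matI)
  fix i j assume ij: "i < dim_row (1\<^sub>m CARD('n))" "j < dim_col (1\<^sub>m CARD('n))"
  then have "(enum i :: 'n) = enum j \<longleftrightarrow> i = j"
    using bij_betw_imp_inj_on[OF bij_enum[where 'n='n]] by (auto simp: inj_on_def)
  with ij show "jnf_mat (mat 1 :: real^'n^'n) $$ (i, j) = 1\<^sub>m CARD('n) $$ (i, j)"
    by (auto simp: jnf_mat_def Finite_Cartesian_Product.mat_def)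
qed (auto simp: jnf_mat_def)

lemma jnf_mat_mpow: "jnf_mat (mpow A k) = jnf_mat A ^\<^sub>m k" for A :: "real^'n^'n"
  by (induction k) (simp_all add: jnf_mat_one jnf_mat_mult)

definition charpoly :: "real^'n^'n \<Rightarrow> complex poly" where
  "charpoly A = Char_Poly.char_poly (jnf_mat A)"

lemma sum_diag_mat_mult_commute:
  fixes X Y :: "complex Matrix.mat"
  assumes "X \<in> carrier_mat n n" "Y \<in> carrier_mat n n"
  shows "(\<Sum>i<n. (X * Y) $$ (i, i)) = (\<Sum>i<n. (Y * X) $$ (i, i))"
proof -
  have "(\<Sum>i<n. (X * Y) $$ (i, i)) = (\<Sum>i<n. \<Sum>j<n. X $$ (i, j) * Y $$ (j, i))"
    using assms by (auto simp: scalar_prod_def atLeast0LessThan intro!: sum.cong)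
  also have "\<dots> = (\<Sum>j<n. \<Sum>i<n. Y $$ (j, i) * X $$ (i, j))"
    by (subst sum.swap) (simp add: mult.commute)
  also have "\<dots> = (\<Sum>i<n. (Y * X) $$ (i, i))"
    using assms by (auto simp: scalar_prod_def atLeast0LessThan intro!: sum.cong)
  finally show ?thesis .
qed

lemma upper_triangular_pow_diag:
  fixes B :: "complex Matrix.mat"
  assumes B: "B \<in> carrier_mat n n" and ut: "upper_triangular B"
  shows "upper_triangular (B ^\<^sub>m k) \<and> (\<forall>i<n. (B ^\<^sub>m k) $$ (i, i) = (B $$ (i, i)) ^ k)"
proof (induction k)
  case 0
  then show ?case using B by (auto simp: upper_triangular_def)
next
  case (Suc k)
  have C: "B ^\<^sub>m k \<in> carrier_mat n n" using B by simp
  have e: "(B ^\<^sub>m k * B) $$ (i, j) = (\<Sum>l<n. (B ^\<^sub>m k) $$ (i, l) * B $$ (l, j))"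
    if "i < n" "j < n" for i j
    using B C that by (auto simp: scalar_prod_def atLeast0LessThan)
  have z1: "(B ^\<^sub>m k) $$ (i, l) = 0" if "l < i" "i < n" for i l
    using Suc C that by (auto simp: upper_triangular_def)
  have z2: "B $$ (i, l) = 0" if "l < i" "i < n" for i l
    using ut B that by (auto simp: upper_triangular_def)
  have "(B ^\<^sub>m k * B) $$ (i, j) = 0" if "j < i" "i < n" for i j
    unfolding e[OF that(2) order.strict_trans[OF that]]
  proof (rule sum.neutral, rule ballI)
    fix l assume "l \<in> {..<n}"
    then show "(B ^\<^sub>m k) $$ (i, l) * B $$ (l, j) = 0"
      using z1[of l i] z2[of j l] that by (cases "l < i") auto
  qed
  moreover have "(B ^\<^sub>m k * B) $$ (i, i) = (B $$ (i, i)) ^ Suc k" if "i < n" for i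
  proof -
    have "(\<Sum>l<n. (B ^\<^sub>m k) $$ (i, l) * B $$ (l, i)) = (\<Sum>l\<in>{i}. (B ^\<^sub>m k) $$ (i, l) * B $$ (l, i))"
    proof (rule sum.mono_neutral_right)
      show "\<forall>l\<in>{..<n} - {i}. (B ^\<^sub>m k) $$ (i, l) * B $$ (l, i) = 0"
        using z1[of _ i] z2[of i] that by (metis DiffE insertI1 lessThan_iff linorder_neqE_nat mult_eq_0_iff)
    qed (use that in auto)
    then show ?thesis using e[OF that that] Suc that by simp
  qed
  ultimately show ?case using B C by (auto simp: upper_triangular_def)
qed

text \<open>In a Schur triangularisation the powers of the triangular factor have the powers of the eigenvalues
on their diagonals, and the trace is invariant under conjugation.  So one list serves both for the
factorisation of the characteristic polynomial and for the traces of all powers.\<close>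

lemma charpoly_eigenvalues:
  fixes A :: "real^'n^'n"
  obtains zs where "length zs = CARD('n)" "charpoly A = (\<Prod>z\<leftarrow>zs. [:- z, 1:])"
    "\<And>k. of_real (trace (mpow A k)) = (\<Sum>z\<leftarrow>zs. z ^ k)"
proof -
  let ?n = "CARD('n)"
  obtain zs where zs: "charpoly A = (\<Prod>z\<leftarrow>zs. [:- z, 1:])" "length zs = ?n"
    using char_poly_factorized[OF jnf_mat_carrier[of A]] unfolding charpoly_def by blast
  obtain B P Q where BPQ: "schur_decomposition (jnf_mat A) zs = (B, P, Q)"
    by (metis prod_cases3)
  note S = schur_decomposition[OF jnf_mat_carrier zs(1)[unfolded charpoly_def] BPQ]
  have w: "similar_mat_wit (jnf_mat A) B P Q" and ut: "upper_triangular B" and d: "diag_mat B = zs"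
    using S by auto
  note W = similar_mat_witD2[OF jnf_mat_carrier w]
  have "of_real (trace (mpow A k)) = (\<Sum>z\<leftarrow>zs. z ^ k)" for k
  proof -
    have c: "B ^\<^sub>m k \<in> carrier_mat ?n ?n" using W by simp
    have "of_real (trace (mpow A k)) = (\<Sum>i<?n. jnf_mat (mpow A k) $$ (i, i))"
      by (simp add: trace_def jnf_mat_def atLeast0LessThan flip: sum_enum)
    also have "\<dots> = (\<Sum>i<?n. (P * (B ^\<^sub>m k * Q)) $$ (i, i))"
      unfolding jnf_mat_mpow similar_mat_wit_pow_id[OF w] 
      using W c by (simp add: assoc_mult_mat[of _ ?n ?n _ ?n _ ?n])
    also have "\<dots> = (\<Sum>i<?n. ((B ^\<^sub>m k * Q) * P) $$ (i, i))"
      using W c by (intro sum_diag_mat_mult_commute) auto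
    also have "(B ^\<^sub>m k * Q) * P = B ^\<^sub>m k"
      using W c by (simp add: assoc_mult_mat[of _ ?n ?n _ ?n _ ?n])
    also have "(\<Sum>i<?n. (B ^\<^sub>m k) $$ (i, i)) = (\<Sum>i<?n. (B $$ (i, i)) ^ k)"
      using upper_triangular_pow_diag[OF _ ut] W by auto
    also have "\<dots> = (\<Sum>z\<leftarrow>zs. z ^ k)"
      unfolding d[symmetric] diag_mat_def using W
      by (simp add: comp_def interv_sum_list_conv_sum_set_nat atLeast0LessThan)
    finally show ?thesis .
  qed
  with that zs show ?thesis by blast
qed

lemma poly_linear_factors_root: "poly (\<Prod>z\<leftarrow>zs. [:- z, 1:]) w = (\<Prod>z\<leftarrow>zs. w - z)" for w :: complex
  by (induction zs) (auto simp: algebra_simps)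

lemma charpoly_root_iff:
  fixes A :: "real^'n^'n"
  shows "poly (charpoly A) z = 0 \<longleftrightarrow> (\<exists>v. v \<noteq> 0 \<and> cmat A *v v = z *s v)"
proof -
  let ?n = "CARD('n)"
  have inj: "inj_on (enum :: nat \<Rightarrow> 'n) {0..<?n}" using bij_enum by (rule bij_betw_imp_inj_on)
  define g where "g = inv_into {0..<?n} (enum :: nat \<Rightarrow> 'n)"
  have g: "enum (g i) = i" "g i < ?n" for i
    using bij_enum[where 'n='n] f_inv_into_f[of i enum "{0..<?n}"] inv_into_into[of i enum "{0..<?n}"]
    unfolding g_def bij_betw_def by auto
  have g': "g (enum i) = i" if "i < ?n" for i
    using that inj unfolding g_def by simp
  have "poly (charpoly A) z = 0 \<longleftrightarrow> Char_Poly.eigenvalue (jnf_mat A) z"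
    unfolding charpoly_def using eigenvalue_root_char_poly[OF jnf_mat_carrier] by blast
  also have "\<dots> \<longleftrightarrow> (\<exists>v. v \<noteq> 0 \<and> cmat A *v v = z *s v)"
  proof
    assume "Char_Poly.eigenvalue (jnf_mat A) z"
    then obtain x where x: "x \<in> carrier_vec ?n" "x \<noteq> 0\<^sub>v ?n" "jnf_mat A *\<^sub>v x = z \<cdot>\<^sub>v x"
      unfolding Char_Poly.eigenvalue_def Char_Poly.eigenvector_def by auto
    define v :: "complex^'n" where "v = (\<chi> i. vec_index x (g i))"
    obtain i where i: "i < ?n" "vec_index x i \<noteq> 0" using x by force
    then have "v $ enum i \<noteq> 0" by (simp add: v_def g')
    then have "v \<noteq> 0" by auto
    moreover have "cmat A *v v = z *s v"
    proof (rule Finite_Cartesian_Product.vec_eq_iff[THEN iffD2], rule allI)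
      fix k :: 'n
      have "(cmat A *v v) $ k = (\<Sum>j=0..<?n. of_real (A $ enum (g k) $ enum j) * vec_index x j)"
        by (simp add: matrix_vector_mult_def cmat_def v_def g g' flip: sum_enum)
      also have "\<dots> = vec_index (jnf_mat A *\<^sub>v x) (g k)"
        using x(1) g(2) by (auto simp: scalar_prod_def jnf_mat_def)
      also have "\<dots> = (z *s v) $ k" using x(1,3) g(2)[of k] by (auto simp: v_def)
      finally show "(cmat A *v v) $ k = (z *s v) $ k" .
    qed
    ultimately show "\<exists>v. v \<noteq> 0 \<and> cmat A *v v = z *s v" by blast
  next
    assume "\<exists>v. v \<noteq> 0 \<and> cmat A *v v = z *s v"
    then obtain v where v: "v \<noteq> 0" "cmat A *v v = z *s v" by blast
    define x where "x = Matrix.vec ?n (\<lambda>i. v $ enum i)"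
    obtain k where k: "v $ k \<noteq> 0" using v(1) by (auto simp: Finite_Cartesian_Product.vec_eq_iff)
    have "vec_index x (g k) \<noteq> 0" using k g by (simp add: x_def)
    then have "x \<noteq> 0\<^sub>v ?n" using g(2)[of k] by auto
    moreover have "jnf_mat A *\<^sub>v x = z \<cdot>\<^sub>v x"
    proof (rule eq_vecI)
      fix i assume "i < dim_vec (z \<cdot>\<^sub>v x)"
      then have i: "i < ?n" by (simp add: x_def)
      have "vec_index (jnf_mat A *\<^sub>v x) i = (\<Sum>j=0..<?n. of_real (A $ enum i $ enum j) * v $ enum j)"
        using i by (auto simp: scalar_prod_def jnf_mat_def x_def)
      also have "\<dots> = (cmat A *v v) $ enum i"
        by (simp add: matrix_vector_mult_def cmat_def flip: sum_enum)
      finally show "vec_index (jnf_mat A *\<^sub>v x) i = vec_index (z \<cdot>\<^sub>v x) i"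
        using v(2) i by (simp add: x_def)
    qed (simp add: x_def)
    ultimately show "Char_Poly.eigenvalue (jnf_mat A) z"
      unfolding Char_Poly.eigenvalue_def Char_Poly.eigenvector_def
      by (intro exI[of _ x]) (simp add: x_def)
  qed
  finally show ?thesis .
qed

lemma charpoly_transpose: "charpoly (transpose A) = charpoly A" for A :: "real^'n^'n"
proof -
  have "jnf_mat (transpose A) = Matrix.transpose_mat (jnf_mat A)"
    by (rule eq_matI) (auto simp: jnf_mat_def transpose_def)
  then show ?thesis by (simp add: charpoly_def char_poly_transpose_mat[OF jnf_mat_carrier])
qed

text \<open>The Leibniz expansion is a polynomial in the entries.\<close>

lemma continuous_on_poly_charpoly:
  fixes M :: "'a::topological_space \<Rightarrow> real^'n^'n"
  assumes "continuous_on S M"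
  shows "continuous_on S (\<lambda>s. poly (charpoly (M s)) z)"
proof -
  let ?n = "CARD('n)"
  have eq: "poly (charpoly (M s)) z = (\<Sum>p | p permutes {0..<?n}. signof p *
      (\<Prod>i = 0..<?n. (if i = p i then z else 0) - of_real (M s $ enum i $ enum (p i))))" for s
  proof -
    have c: "- char_matrix (jnf_mat (M s)) z \<in> carrier_mat ?n ?n"
      by (simp add: char_matrix_def)
    have "(- char_matrix (jnf_mat (M s)) z) $$ (i, p i)
        = (if i = p i then z else 0) - of_real (M s $ enum i $ enum (p i))"
      if "p permutes {0..<?n}" "i < ?n" for p i
    proof -
      have "p i < ?n" using that permutes_in_image[of p "{0..<?n}" i] by simp
      with that show ?thesis by (auto simp: char_matrix_def jnf_mat_def)
    qed
    then show ?thesis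
      unfolding charpoly_def char_poly_matrix[OF jnf_mat_carrier] det_def'[OF c]
      by (intro sum.cong refl) (auto intro!: prod.cong)
  qed
  show ?thesis unfolding eq
    by (intro continuous_on_sum continuous_on_mult continuous_on_prod continuous_on_diff
        continuous_on_const continuous_on_of_real continuous_on_component assms)
qed

section \<open>Matrix exponentials\<close>

text \<open>The exponential \<open>exp (t A)\<close>, written entry by entry as a power series in \<open>t\<close>; the same series with
a complex argument gives the analytic continuation in time that is needed below.\<close>

definition mexp :: "real^'n^'n \<Rightarrow> real \<Rightarrow> real^'n^'n" where
  "mexp A t = (\<chi> i j. \<Sum>k. mpow A k $ i $ j / fact k * t ^ k)"

lemma mpow_commute: "mpow A k ** A = A ** mpow A k"
  by (induction k) (simp, metis mpow.simps(2) matrix_mul_assoc)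

lemma norm_mpow_vec_le:
  fixes A :: "real^'n^'n"
  assumes K: "\<And>x. norm (A *v x) \<le> K * norm x"
  shows "norm (mpow A k *v x) \<le> K ^ k * norm x"
proof (induction k)
  case (Suc k)
  have "0 \<le> K * norm (axis undefined 1 :: real^'n)"
    using K[of "axis undefined 1"] norm_ge_zero order_trans by blast
  then have K0: "0 \<le> K" by simp
  have "norm (mpow A (Suc k) *v x) = norm (A *v (mpow A k *v x))"
    by (simp add: mpow_commute matrix_vector_mul_assoc)
  also have "\<dots> \<le> K * (K ^ k * norm x)"
    using K[of "mpow A k *v x"] mult_left_mono[OF Suc K0] by linarith
  finally show ?case by (simp add: mult.assoc)
qed simp

lemma matrix_vector_bound_exists: "\<exists>K\<ge>0. \<forall>x. norm (A *v x) \<le> K * norm x" for A :: "real^'n^'n"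
  using bounded_linear.nonneg_bounded[OF matrix_vector_mul_bounded_linear[of A]]
  by (auto simp: mult.commute)

lemma abs_mpow_entry_le:
  fixes A :: "real^'n^'n"
  assumes K: "\<And>x. norm (A *v x) \<le> K * norm x"
  shows "\<bar>mpow A k $ i $ j\<bar> \<le> K ^ k"
proof -
  have "mpow A k $ i $ j = (mpow A k *v axis j 1) $ i"
    by (simp add: matrix_vector_mult_basis column_def)
  then show ?thesis
    using component_le_norm_cart[of "mpow A k *v axis j 1" i] norm_mpow_vec_le[OF K, of k "axis j 1"]
    by simp
qed

lemma summable_mexp_entry:
  fixes A :: "real^'n^'n" and z :: "'a::{real_normed_field,banach}"
  shows "summable (\<lambda>k. of_real (mpow A k $ i $ j / fact k) * z ^ k)"
proof -
  obtain K where K: "\<And>x. norm (A *v x) \<le> K * norm x"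
    using matrix_vector_bound_exists[of A] by blast
  show ?thesis
  proof (rule summable_comparison_test)
    show "summable (\<lambda>k. inverse (fact k) * (K * norm z) ^ k)"
      by (rule summable_exp)
    have "norm (of_real (mpow A k $ i $ j / fact k) * z ^ k :: 'a) \<le> inverse (fact k) * (K * norm z) ^ k" for k
    proof -
      have "norm (of_real (mpow A k $ i $ j / fact k) * z ^ k :: 'a) = inverse (fact k) * (\<bar>mpow A k $ i $ j\<bar> * norm z ^ k)"
        by (simp add: norm_mult norm_power divide_inverse mult_ac abs_mult del: of_real_divide of_real_mult)
      also have "\<dots> \<le> inverse (fact k) * (K ^ k * norm z ^ k)"
        by (intro mult_left_mono mult_right_mono abs_mpow_entry_le[OF K]) auto
      finally show ?thesis by (simp add: power_mult_distrib)
    qed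
    then show "\<exists>N. \<forall>k\<ge>N. norm (of_real (mpow A k $ i $ j / fact k) * z ^ k :: 'a)
        \<le> inverse (fact k) * (K * norm z) ^ k" by blast
  qed
qed

lemma summable_mexp_entry_real: "summable (\<lambda>k. mpow A k $ i $ j / fact k * t ^ k)" for t :: real
  using summable_mexp_entry[where 'a=real, of A i j t] by simp

lemma mexp_zero [simp]: "mexp A 0 = mat 1"
proof -
  have "(\<Sum>k. mpow A k $ i $ j / fact k * 0 ^ k) = mat 1 $ i $ j" for i j
    using powser_zero[of "\<lambda>k. mpow A k $ i $ j / fact k"] by simp
  then show ?thesis by (simp add: mexp_def Finite_Cartesian_Product.vec_eq_iff)
qed

lemma mexp_commute: "mexp A t ** A = A ** mexp A t"
proof -
  note sm = summable_mexp_entry_real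
  have "(mexp A t ** A) $ i $ j = (A ** mexp A t) $ i $ j" for i j
  proof -
    have "(mexp A t ** A) $ i $ j = (\<Sum>l\<in>UNIV. \<Sum>k. mpow A k $ i $ l / fact k * t ^ k * A $ l $ j)"
      by (simp only: matrix_matrix_mult_def mexp_def vec_lambda_beta suminf_mult2[OF sm])
    also have "\<dots> = (\<Sum>k. \<Sum>l\<in>UNIV. mpow A k $ i $ l / fact k * t ^ k * A $ l $ j)"
      by (rule suminf_sum[symmetric]) (intro summable_mult2 sm)
    also have "\<dots> = (\<Sum>k. (mpow A k ** A) $ i $ j / fact k * t ^ k)"
      by (simp add: matrix_matrix_mult_def sum_divide_distrib sum_distrib_left mult_ac)
    also have "\<dots> = (\<Sum>k. (A ** mpow A k) $ i $ j / fact k * t ^ k)"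
      by (simp add: mpow_commute)
    also have "\<dots> = (\<Sum>k. \<Sum>l\<in>UNIV. A $ i $ l * (mpow A k $ l $ j / fact k * t ^ k))"
      by (simp add: matrix_matrix_mult_def sum_divide_distrib sum_distrib_left mult_ac)
    also have "\<dots> = (\<Sum>l\<in>UNIV. \<Sum>k. A $ i $ l * (mpow A k $ l $ j / fact k * t ^ k))"
      by (rule suminf_sum) (intro summable_mult sm)
    also have "\<dots> = (A ** mexp A t) $ i $ j"
      by (simp only: matrix_matrix_mult_def mexp_def vec_lambda_beta suminf_mult[OF sm])
    finally show ?thesis .
  qed
  then show ?thesis by (simp add: Finite_Cartesian_Product.vec_eq_iff)
qed

lemma mexp_entry_deriv: "((\<lambda>t. mexp A t $ i $ j) has_real_derivative (A ** mexp A t) $ i $ j) (at t)"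
proof -
  note sm = summable_mexp_entry_real
  let ?c = "\<lambda>k. mpow A k $ i $ j / fact k"
  have "diffs ?c k = mpow A (Suc k) $ i $ j / fact k" for k
    by (simp add: diffs_def field_simps del: of_nat_Suc mpow.simps)
  then have "diffs ?c k * t ^ k = (\<Sum>l\<in>UNIV. mpow A k $ i $ l / fact k * t ^ k * A $ l $ j)" for k
    by (simp add: matrix_matrix_mult_def sum_divide_distrib sum_distrib_left mult_ac)
  then have "(\<Sum>k. diffs ?c k * t ^ k) = (\<Sum>k. \<Sum>l\<in>UNIV. mpow A k $ i $ l / fact k * t ^ k * A $ l $ j)"
    by simp
  also have "\<dots> = (\<Sum>l\<in>UNIV. \<Sum>k. mpow A k $ i $ l / fact k * t ^ k * A $ l $ j)"
    by (rule suminf_sum) (intro summable_mult2 sm)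
  also have "\<dots> = (mexp A t ** A) $ i $ j"
    by (simp only: matrix_matrix_mult_def mexp_def vec_lambda_beta suminf_mult2[OF sm])
  finally have "(\<Sum>k. diffs ?c k * t ^ k) = (A ** mexp A t) $ i $ j" by (simp add: mexp_commute)
  then show ?thesis
    using termdiffs_strong_converges_everywhere[of ?c t, OF sm] by (simp add: mexp_def)
qed

lemma has_vector_derivative_matrixI:
  fixes f :: "real \<Rightarrow> real^'n^'n"
  assumes "\<And>i j. ((\<lambda>t. f t $ i $ j) has_real_derivative D $ i $ j) (at t within S)"
  shows "(f has_vector_derivative D) (at t within S)"
  unfolding has_vector_derivative_def has_derivative_componentwise_within[of f]
proof
  fix b :: "real^'n^'n" assume "b \<in> Basis"
  then obtain i j where b: "b = axis i (axis j 1)" by (auto simp: Basis_vec_def)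
  show "((\<lambda>x. f x \<bullet> b) has_derivative (\<lambda>x. x *\<^sub>R D \<bullet> b)) (at t within S)"
    using assms[of i j] unfolding b has_field_derivative_def
    by (simp add: inner_axis mult.commute[of _ "D $ i $ j"])
qed

lemma matrix_entry_has_derivative:
  fixes f :: "real \<Rightarrow> real^'n^'n"
  assumes "(f has_vector_derivative D) (at t within S)"
  shows "((\<lambda>t. f t $ i $ j) has_real_derivative D $ i $ j) (at t within S)"
  using bounded_linear.has_vector_derivative[OF bounded_linear_vec_nth
      bounded_linear.has_vector_derivative[OF bounded_linear_vec_nth assms, of i], of j]
  by (simp add: has_real_derivative_iff_has_vector_derivative)

lemma has_vector_derivative_matrix_mult:
  fixes f g :: "real \<Rightarrow> real^'n^'n"
  assumes "(f has_vector_derivative f') (at t within S)" "(g has_vector_derivative g') (at t within S)"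
  shows "((\<lambda>t. f t ** g t) has_vector_derivative (f t ** g' + f' ** g t)) (at t within S)"
proof (rule has_vector_derivative_matrixI)
  fix i j
  note d = matrix_entry_has_derivative[OF assms(1)] matrix_entry_has_derivative[OF assms(2)]
  show "((\<lambda>t. (f t ** g t) $ i $ j) has_real_derivative (f t ** g' + f' ** g t) $ i $ j) (at t within S)"
    unfolding matrix_matrix_mult_def
    by (auto intro!: derivative_eq_intros d simp: sum.distrib mult.commute)
qed

lemma continuous_on_matrix_mult:
  fixes f g :: "'a::topological_space \<Rightarrow> real^'n^'n"
  assumes "continuous_on S f" "continuous_on S g"
  shows "continuous_on S (\<lambda>t. f t ** g t)"
  unfolding matrix_matrix_mult_def
  by (intro continuous_on_vec_lambda continuous_on_sum continuous_on_mult continuous_on_component assms)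

lemma mexp_has_vector_derivative:
  assumes "(g has_real_derivative g') (at t within S)"
  shows "((\<lambda>t. mexp A (g t)) has_vector_derivative g' *\<^sub>R (A ** mexp A (g t))) (at t within S)"
proof (rule has_vector_derivative_matrixI)
  fix i j
  show "((\<lambda>t. mexp A (g t) $ i $ j) has_real_derivative (g' *\<^sub>R (A ** mexp A (g t))) $ i $ j) (at t within S)"
    using DERIV_chain2[OF mexp_entry_deriv assms] by (simp add: mult.commute)
qed

lemma continuous_on_mexp: "continuous_on S (mexp A)"
  using mexp_has_vector_derivative[where g="\<lambda>t. t", OF DERIV_ident]
  by (intro continuous_on_vector_derivative) auto

lemma continuous_on_mexp_comp:
  assumes "continuous_on S g" shows "continuous_on S (\<lambda>t. mexp A (g t))"
  using continuous_on_compose[OF assms continuous_on_mexp] by (simp add: comp_def)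

lemma matrix_mult_scaleR_left: "(c *\<^sub>R A) ** B = c *\<^sub>R (A ** B)" for A :: "real^'n^'n"
  by (simp add: matrix_matrix_mult_def Finite_Cartesian_Product.vec_eq_iff sum_distrib_left mult_ac)

lemma mexp_minus: "mexp A (- t) ** mexp A t = mat 1"
proof -
  have "((\<lambda>t. mexp A (- t) ** mexp A t) has_vector_derivative 0) (at t within UNIV)" for t
  proof -
    have "((\<lambda>t. mexp A (- t)) has_vector_derivative (- 1) *\<^sub>R (A ** mexp A (- t))) (at t within UNIV)"
      by (rule mexp_has_vector_derivative) (auto intro!: derivative_eq_intros)
    moreover have "(mexp A has_vector_derivative 1 *\<^sub>R (A ** mexp A t)) (at t within UNIV)"
      by (rule mexp_has_vector_derivative[where g="\<lambda>t. t"]) simp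
    ultimately have "((\<lambda>t. mexp A (- t) ** mexp A t) has_vector_derivative
        mexp A (- t) ** (1 *\<^sub>R (A ** mexp A t)) + ((- 1) *\<^sub>R (A ** mexp A (- t))) ** mexp A t) (at t within UNIV)"
      by (rule has_vector_derivative_matrix_mult)
    moreover have "mexp A (- t) ** (1 *\<^sub>R (A ** mexp A t)) + ((- 1) *\<^sub>R (A ** mexp A (- t))) ** mexp A t = 0"
      unfolding matrix_mult_scaleR_left by (simp add: matrix_mul_assoc mexp_commute)
    ultimately show ?thesis by simp
  qed
  then obtain c where c: "\<And>t. mexp A (- t) ** mexp A t = c"
    using has_vector_derivative_zero_constant[of UNIV "\<lambda>t. mexp A (- t) ** mexp A t"] by auto
  from c[of 0] c[of t] show ?thesis by simp
qed

text \<open>Variation of constants: \<open>exp (- (t - p) A) \<Phi>(t)\<close> has derivative \<open>0\<close> away from finitely many points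
and is continuous, hence constant.\<close>

lemma constant_piece_solution:
  fixes \<Phi> :: "real \<Rightarrow> real^'n^'n"
  assumes cont: "continuous_on {p..q} \<Phi>" and fin: "finite D"
    and der: "\<And>t. t \<in> {p<..<q} - D \<Longrightarrow> (\<Phi> has_vector_derivative A ** \<Phi> t) (at t)"
    and t: "t \<in> {p..q}"
  shows "\<Phi> t = mexp A (t - p) ** \<Phi> p"
proof -
  define g where "g t = mexp A (- (t - p)) ** \<Phi> t" for t
  have "g t = \<Phi> p"
  proof (rule has_derivative_zero_unique_strong_interval[where k="D \<union> {p, q}" and a=p and b=q])
    show "continuous_on {p..q} g"
      unfolding g_def
      by (intro continuous_on_matrix_mult continuous_on_mexp_comp cont continuous_intros)
    fix t assume "t \<in> {p..q} - (D \<union> {p, q})"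
    then have t: "t \<in> {p<..<q} - D" by auto
    have "((\<lambda>t. mexp A (- (t - p))) has_vector_derivative (- 1) *\<^sub>R (A ** mexp A (- (t - p)))) (at t)"
      by (rule mexp_has_vector_derivative) (auto intro!: derivative_eq_intros)
    from has_vector_derivative_matrix_mult[OF this der[OF t]]
    have "(g has_vector_derivative mexp A (- (t - p)) ** (A ** \<Phi> t)
        + ((- 1) *\<^sub>R (A ** mexp A (- (t - p)))) ** \<Phi> t) (at t)"
      unfolding g_def .
    moreover have "mexp A (- (t - p)) ** (A ** \<Phi> t) + ((- 1) *\<^sub>R (A ** mexp A (- (t - p)))) ** \<Phi> t = 0"
      unfolding matrix_mult_scaleR_left by (simp add: matrix_mul_assoc mexp_commute)
    ultimately have "(g has_derivative (\<lambda>h. 0)) (at t)" by (simp add: has_vector_derivative_def)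
    then show "(g has_derivative (\<lambda>h. 0)) (at t within {p..q})" by (rule has_derivative_at_withinI)
  qed (use fin t in \<open>auto simp: g_def\<close>)
  then have "mexp A (t - p) ** (mexp A (- (t - p)) ** \<Phi> t) = mexp A (t - p) ** \<Phi> p"
    by (simp add: g_def)
  then show ?thesis
    using mexp_minus[of A "- (t - p)"] by (simp add: matrix_mul_assoc)
qed

lemma mexp_add:
  assumes "0 \<le> s" shows "mexp A (s + t) = mexp A s ** mexp A t"
proof -
  have "mexp A (s + t) = mexp A (s + t - t) ** mexp A t"
  proof (rule constant_piece_solution[OF continuous_on_mexp finite.emptyI])
    fix r assume "r \<in> {t<..<s + t} - {}"
    show "(mexp A has_vector_derivative A ** mexp A r) (at r)"
      using mexp_has_vector_derivative[where g="\<lambda>t. t" and g'=1 and t=r and S=UNIV and A=A] by simp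
  qed (use assms in auto)
  then show ?thesis by simp
qed

lemma norm_mexp_vec_le:
  fixes A :: "real^'n^'n"
  assumes K: "\<And>x. norm (A *v x) \<le> K * norm x" and t: "0 \<le> t"
  shows "norm (mexp A t *v x) \<le> exp (K * t) * norm x"
proof -
  note sm = summable_mexp_entry_real
  define v where "v k = (t ^ k / fact k) *\<^sub>R (mpow A k *v x)" for k
  have v: "norm (v k) \<le> (inverse (fact k) * (K * t) ^ k) * norm x" for k
    using mult_left_mono[OF norm_mpow_vec_le[OF K, of k x], of "t ^ k / fact k"] t
    by (simp add: v_def power_mult_distrib divide_inverse mult_ac)
  have se: "summable (\<lambda>k. (inverse (fact k) * (K * t) ^ k) * norm x)"
    by (intro summable_mult2 summable_exp)
  have sn: "summable (\<lambda>k. norm (v k))"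
    by (rule summable_comparison_test[OF _ se]) (use v in auto)
  have "(mexp A t *v x) $ i = suminf v $ i" for i
  proof -
    have "(mexp A t *v x) $ i = (\<Sum>j\<in>UNIV. \<Sum>k. mpow A k $ i $ j / fact k * t ^ k * x $ j)"
      by (simp only: matrix_vector_mult_def mexp_def vec_lambda_beta suminf_mult2[OF sm])
    also have "\<dots> = (\<Sum>k. \<Sum>j\<in>UNIV. mpow A k $ i $ j / fact k * t ^ k * x $ j)"
      by (rule suminf_sum[symmetric]) (intro summable_mult2 sm)
    also have "\<dots> = (\<Sum>k. v k $ i)"
      by (simp add: v_def matrix_vector_mult_def sum_distrib_left mult_ac)
    also have "\<dots> = suminf v $ i"
      using bounded_linear.suminf[OF bounded_linear_vec_nth summable_norm_cancel[OF sn]] by simp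
    finally show ?thesis .
  qed
  then have "mexp A t *v x = suminf v" by (simp add: Finite_Cartesian_Product.vec_eq_iff)
  then have "norm (mexp A t *v x) \<le> (\<Sum>k. norm (v k))" using summable_norm[OF sn] by simp
  also have "\<dots> \<le> (\<Sum>k. (inverse (fact k) * (K * t) ^ k) * norm x)"
    by (rule suminf_le[OF v sn se])
  also have "\<dots> = exp (K * t) * norm x"
    by (simp add: exp_def scaleR_conv_of_real suminf_mult2[OF summable_exp, symmetric])
  finally show ?thesis .
qed

section \<open>Switching words and their flows\<close>

text \<open>A word lists durations and matrices of consecutive pieces.  Its head is the piece that comes last in
time: then the recursion on lists extends a trajectory at its end, and list order is the order of the
factors in the product of exponentials.\<close>

type_synonym 'n word = "(real \<times> (real^'n^'n)) list"

definition duration :: "'n::finite word \<Rightarrow> real" where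
  "duration w = (\<Sum>p\<leftarrow>w. fst p)"

lemma duration_simps [simp]: "duration [] = 0" "duration (p # w) = fst p + duration w"
  "duration (v @ w) = duration v + duration w"
  by (simp_all add: duration_def)

primrec flow :: "'n::finite word \<Rightarrow> real^'n^'n" where
  "flow [] = mat 1"
| "flow (p # w) = mexp (snd p) (fst p) ** flow w"

text \<open>After the end of the word the trajectory keeps following the matrix of the last piece; only its values
up to the duration of the word matter.\<close>

primrec traj :: "'n::finite word \<Rightarrow> real \<Rightarrow> real^'n^'n" where
  "traj [] t = mat 1"
| "traj (p # w) t = (if t \<le> duration w then traj w t else mexp (snd p) (t - duration w) ** flow w)"

text \<open>As in the definition of signals, nothing is required at the switching times.\<close>

primrec follows :: "(real \<Rightarrow> real^'n^'n) \<Rightarrow> 'n::finite word \<Rightarrow> bool" where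
  "follows A [] \<longleftrightarrow> True"
| "follows A (p # w) \<longleftrightarrow>
     follows A w \<and> (\<forall>t. duration w < t \<and> t < duration (p # w) \<longrightarrow> A t = snd p)"

definition words :: "(real^'n^'n) set \<Rightarrow> real \<Rightarrow> 'n::finite word set" where
  "words S \<tau> = {w. \<forall>p\<in>set w. \<tau> \<le> fst p \<and> snd p \<in> S}"

lemma words_simps [simp]: "[] \<in> words S \<tau>"
  "p # w \<in> words S \<tau> \<longleftrightarrow> \<tau> \<le> fst p \<and> snd p \<in> S \<and> w \<in> words S \<tau>"
  "v @ w \<in> words S \<tau> \<longleftrightarrow> v \<in> words S \<tau> \<and> w \<in> words S \<tau>"
  by (auto simp: words_def)

abbreviation nonneg_word :: "'n::finite word \<Rightarrow> bool" where
  "nonneg_word w \<equiv> w \<in> words UNIV 0"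

lemma nonneg_wordI: "w \<in> words S \<tau> \<Longrightarrow> 0 \<le> \<tau> \<Longrightarrow> nonneg_word w"
  by (auto simp: words_def)

lemma duration_nonneg: "nonneg_word w \<Longrightarrow> 0 \<le> duration w"
  by (induction w) auto

lemma flow_append: "flow (v @ w) = flow v ** flow w"
  by (induction v) (simp_all add: matrix_mul_assoc)

lemma traj_duration: "nonneg_word w \<Longrightarrow> traj w (duration w) = flow w"
  by (induction w) auto

lemma traj_zero: "nonneg_word w \<Longrightarrow> traj w 0 = mat 1"
  by (induction w) (auto simp: duration_nonneg)

lemma traj_append:
  assumes "nonneg_word v" "nonneg_word w" "0 \<le> t" "t \<le> duration v"
  shows "traj (v @ w) (t + duration w) = traj v t ** flow w"
  using assms
  by (induction v) (auto simp: traj_duration flow_append matrix_mul_assoc)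

lemma follows_cong:
  assumes "nonneg_word w" "\<And>t. 0 < t \<Longrightarrow> t < duration w \<Longrightarrow> A t = B t"
  shows "follows A w \<longleftrightarrow> follows B w"
  using assms
proof (induction w)
  case (Cons p w)
  have d: "0 \<le> duration w" using Cons.prems by (auto intro: duration_nonneg)
  have "follows A w \<longleftrightarrow> follows B w" using Cons by auto
  then show ?case using Cons.prems d by auto
qed simp

lemma follows_append:
  "follows A (v @ w) \<longleftrightarrow> follows A w \<and> follows (\<lambda>t. A (t + duration w)) v"
proof (induction v)
  case (Cons p v)
  have "(\<forall>t. duration (v @ w) < t \<and> t < duration (p # v @ w) \<longrightarrow> A t = snd p) \<longleftrightarrow>
        (\<forall>t. duration v < t \<and> t < duration (p # v) \<longrightarrow> A (t + duration w) = snd p)" (is "?l = ?r")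
  proof
    assume r: ?r
    show ?l
    proof (intro allI impI)
      fix t assume "duration (v @ w) < t \<and> t < duration (p # v @ w)"
      then show "A t = snd p" using r[rule_format, of "t - duration w"] by simp
    qed
  qed auto
  then show ?case using Cons by auto
qed simp

text \<open>The restriction of the notion of fundamental matrix to a bounded interval.  The derivative is taken at
interior points only, which avoids one-sided derivatives when pieces are glued.\<close>

definition solves_upto :: "(real \<Rightarrow> real^'n^'n) \<Rightarrow> real \<Rightarrow> (real \<Rightarrow> real^'n^'n) \<Rightarrow> bool" where
  "solves_upto A T \<Phi> \<longleftrightarrow> \<Phi> 0 = mat 1 \<and> continuous_on {0..T} \<Phi> \<and>
     (\<exists>D. finite D \<and> (\<forall>t\<in>{0<..<T} - D. (\<Phi> has_vector_derivative A t ** \<Phi> t) (at t)))"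

lemma solves_upto_traj:
  assumes "nonneg_word w" "follows A w"
  shows "solves_upto A (duration w) (traj w)"
  using assms
proof (induction w)
  case Nil
  then show ?case by (auto simp: solves_upto_def)
next
  case (Cons p w)
  let ?d = "duration w"
  have nn: "nonneg_word w" "0 \<le> fst p" and d0: "0 \<le> ?d" using Cons.prems by (auto intro: duration_nonneg)
  obtain D where D: "finite D" "continuous_on {0..?d} (traj w)"
      "\<And>t. t \<in> {0<..<?d} - D \<Longrightarrow> (traj w has_vector_derivative A t ** traj w t) (at t)"
    using Cons unfolding solves_upto_def by auto
  have "continuous_on {0..duration (p # w)}
      (\<lambda>t. if t \<le> ?d then traj w t else mexp (snd p) (t - ?d) ** flow w)"
  proof (rule continuous_on_cases_le)
    show "continuous_on {t \<in> {0..duration (p # w)}. t \<le> ?d} (traj w)"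
      by (rule continuous_on_subset[OF D(2)]) auto
    show "continuous_on {t \<in> {0..duration (p # w)}. ?d \<le> t} (\<lambda>t. mexp (snd p) (t - ?d) ** flow w)"
      by (intro continuous_on_matrix_mult continuous_on_mexp_comp continuous_intros)
  qed (use traj_duration[OF nn(1)] in \<open>auto intro: continuous_intros\<close>)
  moreover have "(traj (p # w) has_vector_derivative A t ** traj (p # w) t) (at t)"
    if t: "t \<in> {0<..<duration (p # w)} - insert ?d D" for t
  proof (cases "t < ?d")
    case True
    have "(traj (p # w) has_vector_derivative A t ** traj w t) (at t)"
      by (rule has_vector_derivative_transform_within_open[where S="{..<?d}", OF D(3)])
        (use True t in auto)
    then show ?thesis using True by simp
  next
    case False
    then have gt: "?d < t" using t by auto
    then have At: "A t = snd p" using t Cons.prems(2) by auto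
    have "((\<lambda>t. mexp (snd p) (t - ?d)) has_vector_derivative 1 *\<^sub>R (snd p ** mexp (snd p) (t - ?d))) (at t)"
      by (rule mexp_has_vector_derivative) (auto intro!: derivative_eq_intros)
    from has_vector_derivative_matrix_mult[OF this has_vector_derivative_const[of "flow w"]]
    have der: "((\<lambda>t. mexp (snd p) (t - ?d) ** flow w) has_vector_derivative
        snd p ** (mexp (snd p) (t - ?d) ** flow w)) (at t)"
      by (simp add: matrix_mul_assoc)
    have "(traj (p # w) has_vector_derivative snd p ** (mexp (snd p) (t - ?d) ** flow w)) (at t)"
      by (rule has_vector_derivative_transform_within_open[where S="{?d<..}", OF der]) (use gt in auto)
    then show ?thesis using gt At by simp
  qed
  ultimately show ?case
    using D(1) traj_zero[OF Cons.prems(1)] unfolding solves_upto_def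
    by (intro conjI exI[of _ "insert ?d D"]) auto
qed

lemma solves_upto_unique:
  assumes sol: "solves_upto A T \<Phi>" and "nonneg_word w" "follows A w" "duration w \<le> T"
    and "0 \<le> t" "t \<le> duration w"
  shows "\<Phi> t = traj w t"
  using assms(2-)
proof (induction w arbitrary: t)
  case Nil
  then show ?case using sol by (auto simp: solves_upto_def)
next
  case (Cons p w)
  let ?d = "duration w"
  have nn: "nonneg_word w" "0 \<le> fst p" and d0: "0 \<le> ?d" using Cons.prems by (auto intro: duration_nonneg)
  have IH: "\<Phi> s = traj w s" if "0 \<le> s" "s \<le> ?d" for s
    using Cons.IH[OF nn(1)] Cons.prems that nn(2) by auto
  show ?case
  proof (cases "t \<le> ?d")
    case True
    then show ?thesis using IH Cons.prems by simp
  next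
    case False
    obtain D where D: "finite D" "continuous_on {0..T} \<Phi>"
      "\<And>t. t \<in> {0<..<T} - D \<Longrightarrow> (\<Phi> has_vector_derivative A t ** \<Phi> t) (at t)"
      using sol unfolding solves_upto_def by auto
    have "\<Phi> t = mexp (snd p) (t - ?d) ** \<Phi> ?d"
    proof (rule constant_piece_solution[OF _ D(1), of ?d "duration (p # w)"])
      show "continuous_on {?d..duration (p # w)} \<Phi>"
        by (rule continuous_on_subset[OF D(2)]) (use d0 Cons.prems in auto)
      fix s assume s: "s \<in> {?d<..<duration (p # w)} - D"
      then have "A s = snd p" using Cons.prems(2) by auto
      moreover have "(\<Phi> has_vector_derivative A s ** \<Phi> s) (at s)"
        by (rule D(3)) (use s d0 Cons.prems in auto)
      ultimately show "(\<Phi> has_vector_derivative snd p ** \<Phi> s) (at s)" by simp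
    qed (use False Cons.prems in auto)
    then show ?thesis using False IH[of ?d] d0 traj_duration[OF nn(1)] by simp
  qed
qed

section \<open>Signals and their fundamental matrices\<close>

text \<open>A piece of positive length takes its value in \<open>S\<close> at an interior point.  A piece of length \<open>0\<close> has no
interior, and any element of \<open>S\<close> can be put there.\<close>

lemma signals_upto_imp_word:
  assumes S: "S \<noteq> {}" and \<tau>: "0 \<le> \<tau>" and A: "A \<in> signals_upto S \<tau> T"
  obtains w where "w \<in> words S \<tau>" "duration w = T" "follows A w"
proof -
  obtain m s where AS: "A \<in> {0..T} \<rightarrow> S" and s: "s 0 = 0" "s m = T"
    and p: "\<And>i. i < m \<Longrightarrow> \<tau> \<le> s (Suc i) - s i" "\<And>i. i < m \<Longrightarrow> A constant_on {s i<..<s (Suc i)}"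
    using A unfolding signals_upto_def by blast
  have mono: "s i \<le> s j" if "i \<le> j" "j \<le> m" for i j
    using that
  proof (induction j)
    case (Suc j)
    then show ?case using p(1)[of j] \<tau> by (cases "i = Suc j") force+
  qed simp
  have "\<exists>w\<in>words S \<tau>. duration w = s j \<and> follows A w" if "j \<le> m" for j
    using that
  proof (induction j)
    case 0
    then show ?case using s by (intro bexI[of _ "[]"]) auto
  next
    case (Suc j)
    then obtain w where w: "w \<in> words S \<tau>" "duration w = s j" "follows A w" by auto
    obtain a where a: "a \<in> S" "\<And>t. s j < t \<Longrightarrow> t < s (Suc j) \<Longrightarrow> A t = a"
    proof (cases "s j < s (Suc j)")
      case True
      define t0 where "t0 = (s j + s (Suc j)) / 2"
      have t0: "t0 \<in> {s j<..<s (Suc j)}" using True by (auto simp: t0_def)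
      moreover have "0 \<le> s j" "s (Suc j) \<le> T" using mono[of 0 j] mono[of "Suc j" m] Suc.prems s by auto
      ultimately have "A t0 \<in> S" using AS by auto
      moreover have "A t = A t0" if "s j < t" "t < s (Suc j)" for t
        using p(2)[of j] Suc.prems t0 that unfolding constant_on_def by force
      ultimately show ?thesis using that by blast
    next
      case False
      then show ?thesis using that S by force
    qed
    have "(s (Suc j) - s j, a) # w \<in> words S \<tau>" using w a p(1)[of j] Suc.prems by auto
    moreover have "follows A ((s (Suc j) - s j, a) # w)" using w a by auto
    ultimately show ?case using w(2) by (intro bexI[of _ "(s (Suc j) - s j, a) # w"]) auto
  qed
  from this[of m] s that show ?thesis by auto
qed

lemma word_imp_signals_upto:
  assumes w: "w \<in> words S \<tau>" "w \<noteq> []" and A: "A \<in> {0..duration w} \<rightarrow> S" and f: "follows A w"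
  shows "A \<in> signals_upto S \<tau> (duration w)"
proof -
  have "\<exists>s. s 0 = 0 \<and> s (length w) = duration w \<and>
      (\<forall>i<length w. \<tau> \<le> s (Suc i) - s i \<and> A constant_on {s i<..<s (Suc i)})"
    using w(1) f
  proof (induction w)
    case (Cons p w)
    then obtain s where s: "s 0 = 0" "s (length w) = duration w"
      "\<forall>i<length w. \<tau> \<le> s (Suc i) - s i \<and> A constant_on {s i<..<s (Suc i)}" by auto
    have c: "A constant_on {duration w<..<duration (p # w)}"
      using Cons.prems(2) unfolding constant_on_def by auto
    show ?case
      by (rule exI[of _ "s(Suc (length w) := duration (p # w))"])
        (use s c Cons.prems in \<open>auto simp: less_Suc_eq\<close>)
  qed auto
  then show ?thesis
    using w(2) A unfolding signals_upto_def by (auto intro!: exI[of _ "length w"] simp: Suc_le_eq)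
qed

lemma is_fundamental_solves_upto:
  assumes "is_fundamental_matrix A \<Phi>"
  shows "solves_upto A T \<Phi>"
proof -
  obtain D where D: "\<Phi> 0 = mat 1" "continuous_on {0..} \<Phi>" "finite (D \<inter> {0..T})"
    "\<And>t. t \<in> {0..} - D \<Longrightarrow> (\<Phi> has_vector_derivative A t ** \<Phi> t) (at t within {0..})"
    using assms unfolding is_fundamental_matrix_def by blast
  have "(\<Phi> has_vector_derivative A t ** \<Phi> t) (at t)" if "t \<in> {0<..<T} - D \<inter> {0..T}" for t
  proof -
    have "(\<Phi> has_vector_derivative A t ** \<Phi> t) (at t within {0<..})"
      by (rule has_vector_derivative_within_subset[OF D(4)]) (use that in auto)
    then show ?thesis using at_within_open[of t "{0<..}"] that by simp
  qed
  then show ?thesis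
    using D continuous_on_subset[OF D(2), of "{0..T}"] unfolding solves_upto_def
    by (intro conjI exI[of _ "D \<inter> {0..T}"]) auto
qed

text \<open>The signal follows words of arbitrarily long duration; by uniqueness their trajectories agree wherever
two of them are defined, so they can be glued.\<close>

lemma fundamental_matrix_exists:
  assumes S: "S \<noteq> {}" and \<tau>: "0 \<le> \<tau>" and A: "A \<in> signals S \<tau>"
  shows "is_fundamental_matrix A (fundamental_matrix A)"
proof -
  obtain T where T: "filterlim T at_top sequentially" "\<And>n. A \<in> signals_upto S \<tau> (T n)"
    using A unfolding signals_def by auto
  have "\<exists>w. w \<in> words S \<tau> \<and> duration w = T n \<and> follows A w" for n
    using signals_upto_imp_word[OF S \<tau> T(2)] by metis
  then obtain w where w: "\<And>n. w n \<in> words S \<tau>" "\<And>n. duration (w n) = T n" "\<And>n. follows A (w n)"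
    by metis
  have nn: "nonneg_word (w n)" for n using w(1) \<tau> by (rule nonneg_wordI)
  have ex: "\<exists>n. t < T n" for t
    using T(1) unfolding filterlim_at_top_dense eventually_sequentially by blast
  \<comment> \<open>any word that lasts beyond \<open>t\<close> will do, by uniqueness\<close>
  define N where "N t = (SOME n. t < T n)" for t
  have N: "t < T (N t)" for t unfolding N_def by (rule someI_ex[OF ex])
  define \<Phi> where "\<Phi> t = traj (w (N t)) t" for t
  have sol: "solves_upto A (T n) (traj (w n))" for n
    using solves_upto_traj[OF nn w(3)] w(2) by simp
  have eq: "traj (w m) t = traj (w n) t" if "0 \<le> t" "t \<le> T m" "t \<le> T n" for m n t
  proof -
    have *: "traj (w j) t = traj (w i) t" if "t \<le> T i" "T i \<le> T j" for i j
      by (rule solves_upto_unique[OF sol nn w(3)]) (use that w(2) \<open>0 \<le> t\<close> in auto)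
    show ?thesis using *[of m n] *[of n m] that by (cases "T m \<le> T n") auto
  qed
  have \<Phi>: "\<Phi> t = traj (w n) t" if "0 \<le> t" "t \<le> T n" for t n
    unfolding \<Phi>_def using that eq[of t "N t" n] N[of t] by simp
  have sol\<Phi>: "\<Phi> 0 = mat 1 \<and> continuous_on {0..T n} \<Phi> \<and>
     (\<exists>D. finite D \<and> (\<forall>t\<in>{0<..<T n} - D. (\<Phi> has_vector_derivative A t ** \<Phi> t) (at t)))" for n
  proof -
    obtain D where D: "continuous_on {0..T n} (traj (w n))" "finite D"
      "\<And>t. t \<in> {0<..<T n} - D \<Longrightarrow> (traj (w n) has_vector_derivative A t ** traj (w n) t) (at t)"
      using sol[of n] unfolding solves_upto_def by auto
    have "\<Phi> 0 = mat 1" unfolding \<Phi>_def by (rule traj_zero[OF nn])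
    moreover have "continuous_on {0..T n} \<Phi>"
      using D(1) by (rule continuous_on_eq) (simp add: \<Phi>[of _ n])
    moreover have "(\<Phi> has_vector_derivative A t ** \<Phi> t) (at t)" if t: "t \<in> {0<..<T n} - D" for t
    proof -
      have "(\<Phi> has_vector_derivative A t ** traj (w n) t) (at t)"
        by (rule has_vector_derivative_transform_within_open[where S="{0<..<T n}", OF D(3)[OF t]])
          (use t in \<open>auto simp: \<Phi>[of _ n]\<close>)
      then show ?thesis using t by (simp add: \<Phi>[of _ n])
    qed
    ultimately show ?thesis using D(2) by blast
  qed
  \<comment> \<open>the point \<open>0\<close> is excluded because derivatives are known at interior points only\<close>
  define D where "D = {t. t = 0 \<or> \<not> (\<Phi> has_vector_derivative A t ** \<Phi> t) (at t)}"
  have "is_fundamental_matrix A \<Phi>"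
    unfolding is_fundamental_matrix_def
  proof (intro conjI exI[of _ D] allI ballI)
    show "\<Phi> 0 = mat 1" using sol\<Phi> by blast
    show "continuous_on {0..} \<Phi>"
      unfolding continuous_on_eq_continuous_within
    proof
      fix t :: real assume t: "t \<in> {0..}"
      obtain n where n: "t < T n" using ex by blast
      have "continuous (at t within {0..T n}) \<Phi>"
        using sol\<Phi>[of n] t n unfolding continuous_on_eq_continuous_within by auto
      moreover have "at t within {0..T n} = at t within {0..}"
        by (rule at_within_nhd[of _ "{..<T n}"]) (use n in auto)
      ultimately show "continuous (at t within {0..}) \<Phi>" by simp
    qed
    fix R :: real
    obtain n where n: "R < T n" using ex by blast
    obtain D' where D': "finite D'" "\<And>t. t \<in> {0<..<T n} - D' \<Longrightarrow> (\<Phi> has_vector_derivative A t ** \<Phi> t) (at t)"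
      using sol\<Phi>[of n] by blast
    have "D \<inter> {0..R} \<subseteq> insert 0 D'"
    proof
      fix t assume t: "t \<in> D \<inter> {0..R}"
      show "t \<in> insert 0 D'"
      proof (rule ccontr)
        assume "t \<notin> insert 0 D'"
        then have "t \<in> {0<..<T n} - D'" "t \<noteq> 0" using t n by auto
        then show False using D'(2)[of t] t unfolding D_def by blast
      qed
    qed
    then show "finite (D \<inter> {0..R})" using D'(1) finite_subset by blast
  next
    fix t assume "t \<in> {0..} - D"
    then show "(\<Phi> has_vector_derivative A t ** \<Phi> t) (at t within {0..})"
      unfolding D_def by (auto intro: has_vector_derivative_at_within)
  qed
  then show ?thesis unfolding fundamental_matrix_def by (rule someI[of "is_fundamental_matrix A" \<Phi>])
qed

lemma fundamental_matrix_traj: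
  assumes "S \<noteq> {}" "0 \<le> \<tau>" "A \<in> signals S \<tau>" "nonneg_word w" "follows A w" "0 \<le> t" "t \<le> duration w"
  shows "fundamental_matrix A t = traj w t"
  using solves_upto_unique[OF is_fundamental_solves_upto[OF fundamental_matrix_exists[OF assms(1-3)]]
      assms(4,5) order.refl assms(6,7)] .

lemma signals_word_beyond:
  assumes "S \<noteq> {}" "0 \<le> \<tau>" "A \<in> signals S \<tau>"
  obtains w where "w \<in> words S \<tau>" "t < duration w" "follows A w"
proof -
  obtain T where T: "filterlim T at_top sequentially" "\<And>n. A \<in> signals_upto S \<tau> (T n)"
    using assms(3) unfolding signals_def by auto
  obtain n where "t < T n"
    using T(1) unfolding filterlim_at_top_dense eventually_sequentially by blast
  then show ?thesis using signals_upto_imp_word[OF assms(1,2) T(2)[of n]] that by metis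
qed

text \<open>At an arbitrary time the current piece may still be shorter than \<open>\<tau>\<close>.  Cutting it off leaves a word
that respects the dwell time, at the cost of one exponential over a time at most \<open>\<tau>\<close>, which is
bounded.\<close>

lemma traj_truncate:
  assumes "w \<in> words S \<tau>" "S \<noteq> {}" "0 \<le> \<tau>" "0 \<le> t" "t \<le> duration w"
  shows "\<exists>v\<in>words S \<tau>. \<exists>a\<in>S. \<exists>r. 0 \<le> r \<and> r \<le> \<tau> \<and> duration v + r = t \<and> traj w t = mexp a r ** flow v"
  using assms
proof (induction w)
  case Nil
  then obtain a where "a \<in> S" by auto
  with Nil show ?case by (intro bexI[of _ "[]"] bexI[of _ a] exI[of _ 0]) auto
next
  case (Cons p w)
  show ?case
  proof (cases "t \<le> duration w")
    case True
    then show ?thesis using Cons by auto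
  next
    case False
    show ?thesis
    proof (cases "\<tau> \<le> t - duration w")
      case True
      then show ?thesis using False Cons.prems
        by (intro bexI[of _ "(t - duration w, snd p) # w"] bexI[of _ "snd p"] exI[of _ 0]) auto
    next
      case F2: False
      then show ?thesis using False Cons.prems
        by (intro bexI[of _ w] bexI[of _ "snd p"] exI[of _ "t - duration w"]) auto
    qed
  qed
qed

lemma flow_left_inverse: "\<exists>B. B ** flow w = mat 1"
proof (induction w)
  case Nil
  show ?case by (intro exI[of _ "mat 1"]) simp
next
  case (Cons p w)
  then obtain B where B: "B ** flow w = mat 1" by blast
  have "(B ** mexp (snd p) (- fst p)) ** flow (p # w)
      = B ** ((mexp (snd p) (- fst p) ** mexp (snd p) (fst p)) ** flow w)"
    by (simp add: matrix_mul_assoc)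
  also have "\<dots> = mat 1" using B by (simp add: mexp_minus)
  finally show ?case by blast
qed

lemma flow_nonzero: "flow w *v x \<noteq> 0" if "x \<noteq> 0"
proof
  assume "flow w *v x = 0"
  moreover obtain B where "B ** flow w = mat 1" using flow_left_inverse by blast
  ultimately show False
    using that matrix_vector_mul_assoc[of B "flow w" x] by simp
qed

lemma traj_nonzero: "traj w t *v x \<noteq> 0" if "x \<noteq> 0"
proof (induction w)
  case (Cons p w)
  then show ?case using flow_nonzero[OF that, of "(t - duration w, snd p) # w"] by simp
qed (use that in simp)

lemma fundamental_matrix_nonzero:
  assumes "S \<noteq> {}" "0 \<le> \<tau>" "A \<in> signals S \<tau>" "0 \<le> t" "x \<noteq> 0"
  shows "fundamental_matrix A t *v x \<noteq> 0"
proof -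
  obtain w where w: "w \<in> words S \<tau>" "t < duration w" "follows A w"
    using signals_word_beyond[OF assms(1-3)] by blast
  have "fundamental_matrix A t = traj w t"
    by (rule fundamental_matrix_traj[OF assms(1-3) nonneg_wordI[OF w(1) assms(2)] w(3) assms(4)])
      (use w in simp)
  then show ?thesis using traj_nonzero[OF assms(5)] by simp
qed

section \<open>The periodic signal of a word\<close>

text \<open>The value for the empty word is a dummy: it is never reached from a nonempty word at a nonnegative
time.\<close>

primrec word_signal :: "'n::finite word \<Rightarrow> real \<Rightarrow> real^'n^'n" where
  "word_signal [] t = 0"
| "word_signal (p # w) t = (if t < duration w then word_signal w t else snd p)"

lemma word_signal_in: "w \<in> words S \<tau> \<Longrightarrow> w \<noteq> [] \<Longrightarrow> 0 \<le> t \<Longrightarrow> word_signal w t \<in> S"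
proof (induction w)
  case (Cons p w)
  show ?case
  proof (cases "t < duration w")
    case True
    then have "w \<noteq> []" using Cons.prems(3) by fastforce
    then show ?thesis using Cons.IH Cons.prems True by simp
  next
    case False
    then show ?thesis using Cons.prems by simp
  qed
qed simp

lemma follows_word_signal: "nonneg_word w \<Longrightarrow> follows (word_signal w) w"
proof (induction w)
  case (Cons p w)
  have "follows (word_signal (p # w)) w \<longleftrightarrow> follows (word_signal w) w"
    by (rule follows_cong) (use Cons.prems in simp_all)
  then have f: "follows (word_signal (p # w)) w" using Cons by auto
  show ?case unfolding follows.simps(2) using f by (intro conjI allI impI) (assumption, simp)
qed simp

definition periodic_signal :: "'n::finite word \<Rightarrow> real \<Rightarrow> real^'n^'n" where
  "periodic_signal w t = word_signal w (t - duration w * of_int \<lfloor>t / duration w\<rfloor>)"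

abbreviation repeat_word :: "nat \<Rightarrow> 'n::finite word \<Rightarrow> 'n word" where
  "repeat_word n w \<equiv> concat (replicate n w)"

lemma repeat_word_in: "w \<in> words S \<tau> \<Longrightarrow> repeat_word n w \<in> words S \<tau>"
  by (induction n) auto

lemma duration_repeat_word: "duration (repeat_word n w) = real n * duration w"
  by (induction n) (auto simp: algebra_simps)

lemma repeat_word_Suc: "repeat_word (Suc n) w = repeat_word n w @ w"
  by (induction n) (simp, metis append_assoc concat.simps(2) replicate_Suc)

lemma flow_repeat_word: "flow (repeat_word n w) = mpow (flow w) n"
proof (induction n)
  case (Suc n)
  have "flow (repeat_word (Suc n) w) = flow (repeat_word n w) ** flow w"
    unfolding repeat_word_Suc flow_append ..
  then show ?case by (simp add: Suc)
qed simp

lemma periodic_signal_periodic: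
  assumes "0 < duration w"
  shows "periodic_signal w (t + duration w) = periodic_signal w t"
proof -
  have "(t + duration w) / duration w = t / duration w + 1" using assms by (simp add: field_simps)
  then show ?thesis by (simp add: periodic_signal_def algebra_simps)
qed

lemma follows_periodic_signal:
  assumes w: "nonneg_word w" and pos: "0 < duration w"
  shows "follows (periodic_signal w) (repeat_word n w)"
proof (induction n)
  case (Suc n)
  have "follows (periodic_signal w) w \<longleftrightarrow> follows (word_signal w) w"
  proof (rule follows_cong[OF w])
    fix t assume "0 < t" "t < duration w"
    then have "\<lfloor>t / duration w\<rfloor> = 0" by (simp add: floor_eq_iff)
    then show "periodic_signal w t = word_signal w t" by (simp add: periodic_signal_def)
  qed
  then have "follows (periodic_signal w) w" using follows_word_signal[OF w] by blast
  moreover have "(\<lambda>t. periodic_signal w (t + duration w)) = periodic_signal w"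
    by (intro ext periodic_signal_periodic[OF pos])
  ultimately show ?case unfolding repeat_word_Suc follows_append using Suc by metis
qed simp

lemma periodic_signal_in_signals:
  assumes w: "w \<in> words S \<tau>" and \<tau>: "0 \<le> \<tau>" and pos: "0 < duration w"
  shows "periodic_signal w \<in> signals S \<tau>"
proof -
  have ne: "w \<noteq> []" using pos by auto
  have S: "periodic_signal w t \<in> S" for t
    unfolding periodic_signal_def
  proof (rule word_signal_in[OF w ne])
    have "duration w * of_int \<lfloor>t / duration w\<rfloor> \<le> duration w * (t / duration w)"
      using pos by (intro mult_left_mono) auto
    then show "0 \<le> t - duration w * of_int \<lfloor>t / duration w\<rfloor>" using pos by simp
  qed
  have "filterlim (\<lambda>n. real (Suc n) * duration w) at_top sequentially"
    using pos by real_asymp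
  moreover have "periodic_signal w \<in> signals_upto S \<tau> (real (Suc n) * duration w)" for n
    using word_imp_signals_upto[OF repeat_word_in[OF w], of "Suc n" "periodic_signal w"] ne S
      follows_periodic_signal[OF nonneg_wordI[OF w \<tau>] pos, of "Suc n"]
    by (simp add: duration_repeat_word del: replicate_Suc of_nat_Suc)
  ultimately show ?thesis using S unfolding signals_def by auto
qed

text \<open>Reading the signal along the word repeated once more splits off one period at the beginning of time.\<close>

lemma fundamental_matrix_periodic_shift:
  assumes S: "S \<noteq> {}" and w: "w \<in> words S \<tau>" and \<tau>: "0 \<le> \<tau>" and pos: "0 < duration w" and t: "0 \<le> t"
  shows "fundamental_matrix (periodic_signal w) (t + duration w)
    = fundamental_matrix (periodic_signal w) t ** flow w"
proof -
  have nn: "nonneg_word w" by (rule nonneg_wordI[OF w \<tau>])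
  obtain n where n: "t < real n * duration w" using pos reals_Archimedean3 by blast
  let ?v = "repeat_word n w"
  have nnv: "nonneg_word ?v" by (rule repeat_word_in[OF nn])
  have f: "follows (periodic_signal w) ?v" "follows (periodic_signal w) (?v @ w)"
    using follows_periodic_signal[OF nn pos, of n] follows_periodic_signal[OF nn pos, of "Suc n"]
    unfolding repeat_word_Suc by auto
  note F = fundamental_matrix_traj[OF S \<tau> periodic_signal_in_signals[OF w \<tau> pos]]
  have "fundamental_matrix (periodic_signal w) (t + duration w) = traj (?v @ w) (t + duration w)"
    by (rule F) (use f n t nn nnv pos in \<open>auto simp: duration_repeat_word\<close>)
  also have "\<dots> = traj ?v t ** flow w"
    by (rule traj_append[OF nnv nn t]) (use n in \<open>simp add: duration_repeat_word\<close>)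
  also have "traj ?v t = fundamental_matrix (periodic_signal w) t"
    by (rule F[symmetric]) (use f n t nnv in \<open>auto simp: duration_repeat_word\<close>)
  finally show ?thesis .
qed

text \<open>A real eigenvector of the flow over one period moves along a projective trajectory with that period,
and its norm is multiplied by the modulus of the eigenvalue in every period.\<close>

lemma periodic_pair_of_real_eigenvector:
  assumes S: "S \<noteq> {}" and w: "w \<in> words S \<tau>" and \<tau>: "0 \<le> \<tau>" and pos: "0 < duration w"
    and x: "x \<noteq> 0" "flow w *v x = r *\<^sub>R x"
  shows "(periodic_signal w, x) \<in> periodic_pairs \<tau> S"
    and "fundamental_matrix (periodic_signal w) (real n * duration w) *v x = r ^ n *\<^sub>R x"
proof -
  have r: "r \<noteq> 0"
  proof
    assume "r = 0"
    then have "flow w *v x = 0" unfolding x(2) by (rule ssubst) (rule scaleR_zero_left)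
    then show False using flow_nonzero[OF x(1)] by blast
  qed
  let ?F = "fundamental_matrix (periodic_signal w)"
  note shift = fundamental_matrix_periodic_shift[OF S w \<tau> pos]
  have sh: "?F (t + duration w) *v x = r *\<^sub>R (?F t *v x)" if "0 \<le> t" for t
    unfolding shift[OF that] matrix_vector_mul_assoc[symmetric] x(2)
    by (simp add: matrix_vector_mult_scaleR)
  have "proj_line (?F (t + duration w) *v x) = proj_line (?F t *v x)" if "0 \<le> t" for t
    unfolding proj_line_def sh[OF that]
    using span_image_scale[of "{?F t *v x}" "\<lambda>_. r"] r by simp
  then show "(periodic_signal w, x) \<in> periodic_pairs \<tau> S"
    unfolding periodic_pairs_def
    using periodic_signal_in_signals[OF w \<tau> pos] periodic_signal_periodic[OF pos] pos x(1)
    by (auto intro!: exI[of _ "duration w"])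
  show "?F (real n * duration w) *v x = r ^ n *\<^sub>R x"
  proof (induction n)
    case 0
    show ?case
      using fundamental_matrix_exists[OF S \<tau> periodic_signal_in_signals[OF w \<tau> pos]]
      unfolding is_fundamental_matrix_def by simp
  next
    case (Suc n)
    have "?F (real n * duration w + duration w) *v x = r *\<^sub>R (?F (real n * duration w) *v x)"
      by (rule sh) (use pos in simp)
    moreover have "real (Suc n) * duration w = real n * duration w + duration w"
      by (simp add: algebra_simps)
    ultimately show ?case using Suc by simp
  qed
qed

section \<open>Growth of products of matrices with bounded traces\<close>

primrec mprod :: "(real^'n^'n) list \<Rightarrow> real^'n^'n" where
  "mprod [] = mat 1"
| "mprod (M # Ms) = M ** mprod Ms"

lemma mprod_append: "mprod (Ms @ Ns) = mprod Ms ** mprod Ns"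
  by (induction Ms) (simp_all add: matrix_mul_assoc)

lemma norm_matrix_vector_le: "norm (Y *v x) \<le> norm Y * norm x" for Y :: "real^'n^'n"
proof -
  have "norm (Y *v x) = L2_set (\<lambda>i. norm ((Y *v x) $ i)) UNIV" by (simp add: norm_vec_def)
  also have "\<dots> \<le> L2_set (\<lambda>i. norm (Y $ i) * norm x) UNIV"
  proof (rule L2_set_mono)
    fix i
    have "(Y *v x) $ i = Y $ i \<bullet> x" by (simp add: matrix_vector_mult_def inner_vec_def)
    then show "norm ((Y *v x) $ i) \<le> norm (Y $ i) * norm x"
      using Cauchy_Schwarz_ineq2[of "Y $ i" x] by simp
  qed simp
  also have "\<dots> = norm Y * norm x" by (simp add: L2_set_left_distrib norm_vec_def)
  finally show ?thesis .
qed

lemma linear_trace_mult: "linear (\<lambda>X. trace (X ** Y))" for Y :: "real^'n^'n"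
  by (rule linearI)
    (simp_all add: trace_def matrix_matrix_mult_def sum.distrib sum_distrib_left algebra_simps)

lemma linear_mult_right: "linear (\<lambda>X. X ** Y)" for Y :: "real^'n^'n"
  by (rule linearI)
    (simp_all add: matrix_matrix_mult_def Finite_Cartesian_Product.vec_eq_iff sum.distrib
      sum_distrib_left algebra_simps)

lemma linear_mult_left: "linear (\<lambda>X. Y ** X)" for Y :: "real^'n^'n"
  by (rule linearI)
    (simp_all add: matrix_matrix_mult_def Finite_Cartesian_Product.vec_eq_iff sum.distrib
      sum_distrib_left algebra_simps)

lemma linear_apply_vec: "linear (\<lambda>X. X *v x)" for x :: "real^'n"
  by (rule linearI)
    (simp_all add: matrix_vector_mult_def Finite_Cartesian_Product.vec_eq_iff sum.distrib
      sum_distrib_left algebra_simps)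

lemma sum_list_if_eq: "(\<Sum>z\<leftarrow>zs. if z = a then c else 0) = of_nat (count_list zs a) * (c :: complex)"
  by (induction zs) (auto simp: algebra_simps)

text \<open>All power sums of the eigenvalues vanish.  If \<open>1\<close> were an eigenvalue, take the polynomial \<open>q\<close> that
vanishes at \<open>0\<close> and at all eigenvalues other than \<open>1\<close>: the sum of \<open>q\<close> over the eigenvalues is a
combination of power sums, hence \<open>0\<close>, but it is also \<open>q(1) \<noteq> 0\<close> times the multiplicity of \<open>1\<close>.\<close>

lemma no_fixed_vector_of_zero_traces:
  fixes X :: "real^'n^'n"
  assumes tr: "\<And>k. trace (mpow X (Suc k)) = 0" and fp: "X *v w = w"
  shows "w = 0"
proof (rule ccontr)
  assume "w \<noteq> 0"
  obtain zs where zs: "charpoly X = (\<Prod>z\<leftarrow>zs. [:- z, 1:])"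
    "\<And>k. of_real (trace (mpow X k)) = (\<Sum>z\<leftarrow>zs. z ^ k)"
    using charpoly_eigenvalues[of X] by metis
  define v :: "complex^'n" where "v = (\<chi> i. of_real (w $ i))"
  have "v \<noteq> 0" using \<open>w \<noteq> 0\<close> by (auto simp: v_def Finite_Cartesian_Product.vec_eq_iff)
  moreover have "cmat X *v v = 1 *s v"
  proof -
    have "(cmat X *v v) $ i = of_real ((X *v w) $ i)" for i
      by (simp add: cmat_def v_def matrix_vector_mult_def)
    then show ?thesis unfolding fp by (simp add: v_def Finite_Cartesian_Product.vec_eq_iff)
  qed
  ultimately have "poly (charpoly X) 1 = 0" unfolding charpoly_root_iff by blast
  then have one: "1 \<in> set zs" by (auto simp: zs(1) poly_linear_factors_root prod_list_zero_iff)
  \<comment> \<open>the linear factor through the origin removes the zeroth power sum, which is the dimension\<close>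
  define q where "q = [:0, 1:] * (\<Prod>z\<in>set zs - {1}. [:- z, 1:])"
  have q0: "poly.coeff q 0 = 0" by (simp add: q_def)
  have qz: "poly q z = (if z = 1 then poly q 1 else 0)" if "z \<in> set zs" for z
    using that by (auto simp: q_def poly_prod)
  have q1: "poly q 1 \<noteq> 0" by (auto simp: q_def poly_prod)
  have "(\<Sum>z\<leftarrow>zs. poly q z) = (\<Sum>z\<leftarrow>zs. \<Sum>k\<le>degree q. poly.coeff q k * z ^ k)"
    by (simp add: poly_altdef)
  also have "\<dots> = (\<Sum>k\<le>degree q. poly.coeff q k * (\<Sum>z\<leftarrow>zs. z ^ k))"
    by (induction zs) (simp_all add: sum.distrib distrib_left)
  also have "\<dots> = 0"
  proof (rule sum.neutral, rule ballI)
    fix k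
    show "poly.coeff q k * (\<Sum>z\<leftarrow>zs. z ^ k) = 0"
      using q0 tr[of "k - 1"] zs(2)[of k] by (cases k) auto
  qed
  finally have "(\<Sum>z\<leftarrow>zs. poly q z) = 0" .
  moreover have "(\<Sum>z\<leftarrow>zs. poly q z) = (\<Sum>z\<leftarrow>zs. if z = 1 then poly q 1 else 0)"
    using qz by (intro arg_cong[of _ _ sum_list] map_cong) auto
  ultimately have "count_list zs 1 = 0" using q1 by (simp add: sum_list_if_eq)
  then show False using one by (simp add: count_list_0_iff)
qed

text \<open>A form of the nilpotency of nil algebras.  Take a maximal proper invariant subspace \<open>U\<close> of \<open>V\<close>.  If
some \<open>X v\<close> is not in \<open>U\<close>, then \<open>R v + U\<close> is invariant and larger than \<open>U\<close>, so it is \<open>V\<close> and contains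
\<open>v\<close>; thus \<open>v - Y v \<in> U\<close> for some \<open>Y\<close> in the algebra.  Then \<open>1 - Y\<close> maps \<open>U + \<real> v\<close> into the smaller
space \<open>U\<close>, so it has a kernel, which is a fixed vector of \<open>Y\<close>.\<close>

lemma nil_algebra_shrinks:
  fixes R :: "(real^'n^'n) set"
  assumes R: "subspace R" "\<And>X Y. X \<in> R \<Longrightarrow> Y \<in> R \<Longrightarrow> X ** Y \<in> R"
    and nil: "\<And>X w. X \<in> R \<Longrightarrow> X *v w = w \<Longrightarrow> w = 0"
    and V: "subspace V" "V \<noteq> {0}" "\<And>X v. X \<in> R \<Longrightarrow> v \<in> V \<Longrightarrow> X *v v \<in> V"
  obtains U where "subspace U" "U \<subset> V" "\<And>X v. X \<in> R \<Longrightarrow> v \<in> V \<Longrightarrow> X *v v \<in> U"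
proof -
  define P where "P U \<longleftrightarrow> subspace U \<and> U \<subset> V \<and> (\<forall>X\<in>R. \<forall>u\<in>U. X *v u \<in> U)" for U
  have "P {0}" using V subspace_0[OF V(1)] by (auto simp: P_def subspace_single_0)
  moreover have "\<forall>U. P U \<longrightarrow> dim U < Suc DIM(real^'n)"
    by (simp only: less_Suc_eq_le dim_subset_UNIV simp_thms)
  ultimately obtain U where U: "P U" "\<And>W. P W \<Longrightarrow> dim W \<le> dim U"
    using ex_has_greatest_nat[of P "{0}" dim "Suc DIM(real^'n)"] by (metis less_imp_le)
  have sU: "subspace U" "U \<subset> V" "\<And>X u. X \<in> R \<Longrightarrow> u \<in> U \<Longrightarrow> X *v u \<in> U"
    using U(1) by (auto simp: P_def)
  have "X *v v \<in> U" if X: "X \<in> R" and v: "v \<in> V" for X v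
  proof (rule ccontr)
    assume n: "X *v v \<notin> U"
    have vU: "v \<notin> U" using n sU(3)[OF X] by blast
    define W where "W = {Y *v v + u | Y u. Y \<in> R \<and> u \<in> U}"
    have "subspace W"
    proof (rule subspaceI)
      show "0 \<in> W"
        using subspace_0[OF R(1)] subspace_0[OF sU(1)] unfolding W_def
        by (intro CollectI exI[of _ 0]) simp
    next
      fix x y assume "x \<in> W" "y \<in> W"
      then obtain Y u Z t where *: "x = Y *v v + u" "y = Z *v v + t" "Y \<in> R" "Z \<in> R" "u \<in> U" "t \<in> U"
        unfolding W_def by blast
      have "x + y = (Y + Z) *v v + (u + t)" using * by (simp add: matrix_vector_mult_add_rdistrib)
      then show "x + y \<in> W"
        using * subspace_add[OF R(1)] subspace_add[OF sU(1)] unfolding W_def by blast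
    next
      fix c x assume "x \<in> W"
      then obtain Y u where *: "x = Y *v v + u" "Y \<in> R" "u \<in> U" unfolding W_def by blast
      have "c *\<^sub>R x = (c *\<^sub>R Y) *v v + c *\<^sub>R u"
        using * by (simp add: scaleR_add_right scaleR_matrix_vector_assoc)
      then show "c *\<^sub>R x \<in> W"
        using * subspace_scale[OF R(1)] subspace_scale[OF sU(1)] unfolding W_def by blast
    qed
    moreover have "W \<subseteq> V"
      using V(1,3) v sU(2) subspace_add[OF V(1)] unfolding W_def by blast
    moreover have "Y *v x \<in> W" if "Y \<in> R" "x \<in> W" for Y x
    proof -
      obtain Z u where *: "x = Z *v v + u" "Z \<in> R" "u \<in> U" using \<open>x \<in> W\<close> unfolding W_def by blast
      have "Y *v x = (Y ** Z) *v v + Y *v u"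
        using * by (simp add: matrix_vector_right_distrib matrix_vector_mul_assoc)
      then show ?thesis using * R(2) sU(3) that(1) unfolding W_def by blast
    qed
    moreover have UW: "U \<subset> W"
    proof -
      have "u \<in> W" if "u \<in> U" for u
        using subspace_0[OF R(1)] that unfolding W_def by (intro CollectI exI[of _ 0] exI[of _ u]) simp
      moreover have "X *v v \<in> W"
        using subspace_0[OF sU(1)] X unfolding W_def by (intro CollectI exI[of _ X] exI[of _ 0]) simp
      ultimately show ?thesis using n by blast
    qed
    moreover have "\<not> P W"
    proof
      assume "P W"
      then have "dim W \<le> dim U" by (rule U(2))
      then show False
        using UW sU(1) \<open>subspace W\<close> subspace_dim_equal[of U W] by auto
    qed
    ultimately have "W = V" unfolding P_def by blast
    then obtain Y u where Y: "v = Y *v v + u" "Y \<in> R" "u \<in> U" using v unfolding W_def by blast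
    let ?f = "\<lambda>x. x - Y *v x"
    have lin: "linear ?f"
      by (intro linear_compose_sub linear_ident matrix_vector_mul_linear)
    have "?f ` span (insert v U) \<subseteq> U"
    proof -
      have "v - Y *v v = u" using Y(1) by (metis add_diff_cancel_left')
      then have "?f ` insert v U \<subseteq> U"
        using Y(2,3) sU(3) subspace_diff[OF sU(1)] by (intro image_subsetI) (elim insertE; simp)
      then have "span (?f ` insert v U) \<subseteq> U" using span_minimal sU(1) by blast
      then show ?thesis using linear_span_image[OF lin] by blast
    qed
    moreover have "inj_on ?f (span (insert v U))"
    proof (rule inj_onI)
      fix x y assume "?f x = ?f y"
      then have "Y *v (x - y) = x - y" by (simp add: algebra_simps matrix_vector_mult_diff_distrib)
      then show "x = y" using nil[OF Y(2)] by force
    qed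
    then have "dim (?f ` span (insert v U)) = dim (span (insert v U))"
      by (intro dim_image_eq[OF lin]) (simp add: span_span)
    ultimately have "dim (insert v U) \<le> dim U" using dim_subset[of "?f ` span (insert v U)" U] by simp
    then show False using vU sU(1) by (simp add: dim_insert span_eq_iff[THEN iffD2])
  qed
  with that sU(1,2) show ?thesis by blast
qed

text \<open>The radical of the trace form on the algebra spanned by \<open>G\<close>.\<close>

definition trace_radical :: "(real^'n^'n) set \<Rightarrow> (real^'n^'n) set" where
  "trace_radical G = {X \<in> span G. \<forall>Y\<in>G. trace (X ** Y) = 0}"

locale matrix_monoid =
  fixes G :: "(real^'n^'n) set"
  assumes one: "mat 1 \<in> G" and mult: "M \<in> G \<Longrightarrow> N \<in> G \<Longrightarrow> M ** N \<in> G"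
begin

lemma span_mult:
  assumes "X \<in> span G" "Y \<in> span G"
  shows "X ** Y \<in> span G"
proof -
  have 1: "M ** Y \<in> span G" if "M \<in> G" for M
  proof -
    have "(\<lambda>Z. M ** Z) ` span G \<subseteq> span G"
      unfolding linear_span_image[OF linear_mult_left, symmetric]
      using mult[OF that] by (intro span_mono) auto
    then show ?thesis using assms(2) by blast
  qed
  have "(\<lambda>Z. Z ** Y) ` span G \<subseteq> span G"
    unfolding linear_span_image[OF linear_mult_right, symmetric]
    using 1 by (intro span_minimal) auto
  then show ?thesis using assms(1) by blast
qed

lemma mpow_in_span: "X \<in> span G \<Longrightarrow> mpow X k \<in> span G"
  by (induction k) (auto intro: span_mult span_base one)

lemma trace_radicalD:
  assumes "X \<in> trace_radical G" "Y \<in> span G"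
  shows "trace (X ** Y) = 0"
proof -
  have "linear (\<lambda>Y. trace (X ** Y))"
    using linear_trace_mult[of X] by (simp add: trace_mul_sym[of X])
  moreover have "trace (X ** Y) = 0" if "Y \<in> G" for Y using assms(1) that by (auto simp: trace_radical_def)
  ultimately show ?thesis using linear_eq_0_on_span[of "\<lambda>Y. trace (X ** Y)" G Y] assms(2) by blast
qed

lemma trace_radical_subspace: "subspace (trace_radical G)"
proof (rule subspaceI)
  fix X Y c assume "X \<in> trace_radical G" "Y \<in> trace_radical G"
  then show "X + Y \<in> trace_radical G"
    by (auto simp: trace_radical_def span_add linear_add[OF linear_trace_mult])
next
  fix X c assume "X \<in> trace_radical G"
  then show "c *\<^sub>R X \<in> trace_radical G"
    by (auto simp: trace_radical_def span_scale linear_scale[OF linear_trace_mult])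
qed (auto simp: trace_radical_def span_zero trace_def)

lemma trace_radical_ideal:
  assumes "X \<in> trace_radical G" "Y \<in> span G"
  shows "X ** Y \<in> trace_radical G" "Y ** X \<in> trace_radical G"
proof -
  have X: "X \<in> span G" using assms(1) by (simp add: trace_radical_def)
  have "trace (X ** Y ** Z) = 0" "trace (Y ** X ** Z) = 0" if "Z \<in> G" for Z
  proof -
    show "trace (X ** Y ** Z) = 0"
      using trace_radicalD[OF assms(1) span_mult[OF assms(2) span_base[OF that]]]
      by (simp add: matrix_mul_assoc)
    show "trace (Y ** X ** Z) = 0"
      using trace_radicalD[OF assms(1) span_mult[OF span_base[OF that] assms(2)]]
      by (metis matrix_mul_assoc trace_mul_sym)
  qed
  then show "X ** Y \<in> trace_radical G" "Y ** X \<in> trace_radical G"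
    using X assms(2) span_mult by (auto simp: trace_radical_def)
qed

lemma trace_radical_nil:
  assumes "X \<in> trace_radical G" "X *v w = w"
  shows "w = 0"
proof (rule no_fixed_vector_of_zero_traces[OF _ assms(2)])
  fix k
  have "mpow X k \<in> span G" using assms(1) by (intro mpow_in_span) (simp add: trace_radical_def)
  from trace_radicalD[OF assms(1) this] show "trace (mpow X (Suc k)) = 0"
    by (simp add: trace_mul_sym[of _ X])
qed

text \<open>Modulo its radical the trace form is nondegenerate.  So an element of \<open>G\<close> is determined modulo the
radical by its trace products with a basis of the algebra taken from \<open>G\<close>, and these are traces of
elements of \<open>G\<close>, hence bounded.\<close>

lemma bounded_modulo_trace_radical:
  assumes c: "\<And>M. M \<in> G \<Longrightarrow> \<bar>trace M\<bar> \<le> c"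
  obtains C where "0 \<le> C" "\<And>M. M \<in> G \<Longrightarrow> \<exists>Y\<in>span G. norm Y \<le> C \<and> M - Y \<in> trace_radical G"
proof -
  obtain B where B: "B \<subseteq> G" "independent B" "G \<subseteq> span B"
    using maximal_independent_subset[of G] by blast
  have fin: "finite B" using B(2) by (rule independent_imp_finite)
  \<comment> \<open>encodes the family of traces against the basis: as the basis is independent, \<open>L X\<close> vanishes iff all of them do\<close>
  define L where "L X = (\<Sum>b\<in>B. trace (X ** b) *\<^sub>R b)" for X
  have linL: "linear L"
    unfolding L_def
  proof (intro linear_compose_sum ballI)
    fix b
    show "linear (\<lambda>X. trace (X ** b) *\<^sub>R b)"
      by (rule linearI) (simp_all add: trace_def matrix_matrix_mult_def sum.distrib scaleR_add_left sum_distrib_left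
          algebra_simps)
  qed
  have LR: "X \<in> trace_radical G \<longleftrightarrow> L X = 0" if "X \<in> span G" for X
  proof
    assume "X \<in> trace_radical G"
    then show "L X = 0" using B(1) by (auto simp: L_def trace_radical_def intro!: sum.neutral)
  next
    assume "L X = 0"
    then have "(\<Sum>b\<in>B. trace (X ** b) *\<^sub>R b) = 0" unfolding L_def .
    from independentD[OF B(2) fin subset_refl this]
    have 1: "\<And>b. b \<in> B \<Longrightarrow> trace (X ** b) = 0" .
    have "linear (\<lambda>Y. trace (X ** Y))"
      unfolding trace_mul_sym[of X] by (rule linear_trace_mult)
    from linear_eq_0_on_span[OF this 1]
    have "\<And>Y. Y \<in> span B \<Longrightarrow> trace (X ** Y) = 0" .
    then show "X \<in> trace_radical G" using that B(3) by (auto simp: trace_radical_def)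
  qed
  define Q where "Q = {Y \<in> span G. \<forall>Z\<in>trace_radical G. Y \<bullet> Z = 0}"
  have sQ: "subspace Q"
    by (rule subspaceI) (auto simp: Q_def inner_add_left span_add span_scale span_zero)
  have "\<forall>Y\<in>Q. L Y = 0 \<longrightarrow> Y = 0"
  proof (intro ballI impI)
    fix Y assume "Y \<in> Q" "L Y = 0"
    then have "Y \<in> trace_radical G" "\<And>Z. Z \<in> trace_radical G \<Longrightarrow> Y \<bullet> Z = 0"
      using LR[of Y] by (auto simp: Q_def)
    then have "Y \<bullet> Y = 0" by blast
    then show "Y = 0" by simp
  qed
  then obtain e where e: "e > 0" "\<And>Y. Y \<in> Q \<Longrightarrow> e * norm Y \<le> norm (L Y)"
    using injective_imp_isometric[OF closed_subspace[OF sQ] sQ] linL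
    by (metis linear_conv_bounded_linear)
  define K where "K = (\<Sum>b\<in>B. c * norm b)"
  have K: "norm (L M) \<le> K" if "M \<in> G" for M
    unfolding L_def K_def
  proof (rule sum_norm_le)
    fix b assume "b \<in> B"
    then have "M ** b \<in> G" using B(1) by (intro mult[OF that]) auto
    then have "\<bar>trace (M ** b)\<bar> \<le> c" by (rule c)
    then show "norm (trace (M ** b) *\<^sub>R b) \<le> c * norm b" by (simp add: mult_right_mono)
  qed
  have "\<exists>Y\<in>span G. norm Y \<le> K / e \<and> M - Y \<in> trace_radical G" if M: "M \<in> G" for M
  proof -
    obtain Y Z where YZ: "Y \<in> span (trace_radical G)" "\<And>w. w \<in> span (trace_radical G) \<Longrightarrow> orthogonal Z w"
      "M = Y + Z"
      using orthogonal_subspace_decomp_exists[of "trace_radical G" M] by blast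
    have Y: "Y \<in> trace_radical G" using YZ(1) trace_radical_subspace by (simp add: span_eq_iff[THEN iffD2])
    then have "Y \<in> span G" by (simp add: trace_radical_def)
    then have Z: "Z \<in> span G" using YZ(3) span_diff[of M G Y] span_base[OF M] by simp
    then have "Z \<in> Q" using YZ(2) span_base unfolding Q_def orthogonal_def by blast
    moreover have "L Z = L M" using YZ(3) linear_add[OF linL, of Y Z] LR[OF \<open>Y \<in> span G\<close>] Y by simp
    ultimately have "e * norm Z \<le> K" using e(2)[of Z] K[OF M] by simp
    then have "norm Z \<le> K / e" using e(1) by (simp add: field_simps)
    moreover have "M - Z = Y" using YZ(3) by simp
    ultimately show ?thesis using Z Y by blast
  qed
  moreover have "0 \<le> K" using K[OF one] norm_ge_zero order_trans by blast
  then have "0 \<le> K / e" using e(1) by simp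
  ultimately show ?thesis using that by blast
qed

lemma invariant_span:
  assumes "\<And>M v. M \<in> G \<Longrightarrow> v \<in> V \<Longrightarrow> M *v v \<in> V" "subspace V" "X \<in> span G" "v \<in> V"
  shows "X *v v \<in> V"
proof -
  have "(\<lambda>Z. Z *v v) ` span G \<subseteq> V"
    unfolding linear_span_image[OF linear_apply_vec, symmetric]
    using assms by (intro span_minimal) auto
  then show ?thesis using assms(3) by blast
qed

text \<open>Induction on the dimension.  The radical maps \<open>V\<close> into a smaller invariant subspace \<open>W\<close>.  Modulo \<open>W\<close> all
products act like elements \<open>Y\<close> of a bounded set, so the difference \<open>P x - Y x\<close> between a product and its
bounded representative lies in \<open>W\<close>; adding one factor changes this difference by a bounded vector of
\<open>W\<close>, on which later factors act with polynomial growth by the induction hypothesis.  Summing these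
contributions raises the degree of the bound by one.\<close>

lemma growth_on_invariant_subspace:
  assumes c: "\<And>M. M \<in> G \<Longrightarrow> \<bar>trace M\<bar> \<le> c"
    and \<Sigma>: "\<Sigma> \<subseteq> G" "\<And>M x. M \<in> \<Sigma> \<Longrightarrow> norm (M *v x) \<le> b * norm x" and b: "0 \<le> b"
    and "subspace V" "\<And>M v. M \<in> G \<Longrightarrow> v \<in> V \<Longrightarrow> M *v v \<in> V"
  shows "\<exists>C k. 0 \<le> C \<and> (\<forall>Ms\<in>lists \<Sigma>. \<forall>x\<in>V.
    norm (mprod Ms *v x) \<le> C * (1 + real (length Ms)) ^ k * norm x)"
  using assms(5-)
proof (induction "dim V" arbitrary: V rule: less_induct)
  case less
  show ?case
  proof (cases "V = {0}")
    case True
    then show ?thesis by (intro exI[of _ 0]) auto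
  next
    case False
    let ?R = "trace_radical G"
    have RG: "?R \<subseteq> span G" by (auto simp: trace_radical_def)
    have Vinv: "X *v v \<in> V" if "X \<in> span G" "v \<in> V" for X v
      using invariant_span[OF less.prems(2,1)] that by blast
    obtain U where U: "subspace U" "U \<subset> V" "\<And>X v. X \<in> ?R \<Longrightarrow> v \<in> V \<Longrightarrow> X *v v \<in> U"
    proof (rule nil_algebra_shrinks[of ?R V])
      show "X ** Y \<in> ?R" if "X \<in> ?R" "Y \<in> ?R" for X Y
        using trace_radical_ideal(1)[OF that(1)] that(2) RG by blast
      show "X *v v \<in> V" if "X \<in> ?R" "v \<in> V" for X v
        using that RG Vinv by blast
    qed (use trace_radical_subspace trace_radical_nil less.prems False in blast)+
    define W where "W = span {X *v v | X v. X \<in> ?R \<and> v \<in> V}"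
    have WU: "W \<subseteq> U" unfolding W_def using U by (intro span_minimal) auto
    have sW: "subspace W" unfolding W_def by (rule subspace_span)
    have W: "X *v v \<in> W" if "X \<in> ?R" "v \<in> V" for X v
      unfolding W_def using that by (intro span_base) blast
    have Winv: "M *v w \<in> W" if M: "M \<in> G" and w: "w \<in> W" for M w
    proof -
      have "(*v) M ` W \<subseteq> W"
        unfolding W_def linear_span_image[OF matrix_vector_mul_linear, symmetric]
      proof (rule span_mono, safe)
        fix X v assume "X \<in> ?R" "v \<in> V"
        then show "\<exists>X' v'. M *v (X *v v) = X' *v v' \<and> X' \<in> ?R \<and> v' \<in> V"
          using trace_radical_ideal(2)[OF _ span_base[OF M], of X]
          by (auto simp: matrix_vector_mul_assoc)
      qed
      then show ?thesis using w by blast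
    qed
    have "dim W < dim V"
    proof -
      have "W \<noteq> V" "W \<subseteq> V" using WU U(2) by auto
      then show ?thesis using subspace_dim_equal[OF sW less.prems(1)] dim_subset[of W V] by force
    qed
    from less.hyps[OF this sW Winv] obtain C1 k where C1: "0 \<le> C1"
      "\<And>Ms x. Ms \<in> lists \<Sigma> \<Longrightarrow> x \<in> W \<Longrightarrow> norm (mprod Ms *v x) \<le> C1 * (1 + real (length Ms)) ^ k * norm x"
      by blast
    obtain C2 where C2: "0 \<le> C2" "\<And>M. M \<in> G \<Longrightarrow> \<exists>Y\<in>span G. norm Y \<le> C2 \<and> M - Y \<in> ?R"
      using bounded_modulo_trace_radical[OF c] by blast
    obtain Y where Y: "\<And>M. M \<in> G \<Longrightarrow> Y M \<in> span G" "\<And>M. M \<in> G \<Longrightarrow> norm (Y M) \<le> C2"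
      "\<And>M. M \<in> G \<Longrightarrow> M - Y M \<in> ?R"
      using C2(2) by metis
    have Yx: "norm (Y M *v x) \<le> C2 * norm x" if "M \<in> G" for M x
      using norm_matrix_vector_le[of "Y M" x] mult_right_mono[OF Y(2)[OF that], of "norm x"] by simp
    have GP: "mprod Ms \<in> G" if "Ms \<in> lists \<Sigma>" for Ms
      using that by (induction Ms) (use one mult \<Sigma>(1) in auto)
    define D where "D = 1 + C2 + b * C2"
    have D: "1 + C2 \<le> D" "b * C2 + C2 \<le> D" "0 \<le> D" using b C2(1) by (auto simp: D_def)
    have dW: "mprod Ms *v x - Y (mprod Ms) *v x \<in> W" if "Ms \<in> lists \<Sigma>" "x \<in> V" for Ms x
      using W[OF Y(3)[OF GP[OF that(1)]] that(2)] by (simp add: matrix_vector_mult_diff_rdistrib)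
    \<comment> \<open>the factors \<open>Ns\<close> still to come are carried along, so that the induction can move factors from one list to the other\<close>
    have step: "norm (mprod Ns *v (mprod Ms *v x - Y (mprod Ms) *v x))
        \<le> (1 + real (length Ms)) * (C1 * (1 + real (length Ns) + real (length Ms)) ^ k * (D * norm x))"
      if Ms: "Ms \<in> lists \<Sigma>" and Ns: "Ns \<in> lists \<Sigma>" and x: "x \<in> V" for Ms Ns x
      using Ms Ns
    proof (induction Ms arbitrary: Ns)
      case Nil
      have "norm (x - Y (mat 1) *v x) \<le> D * norm x"
      proof -
        have "norm (x - Y (mat 1) *v x) \<le> norm x + C2 * norm x"
          using norm_triangle_ineq4[of x "Y (mat 1) *v x"] Yx[OF one, of x] by linarith
        also have "\<dots> = (1 + C2) * norm x" by (simp add: algebra_simps)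
        also have "\<dots> \<le> D * norm x" using D(1) by (intro mult_right_mono) auto
        finally show ?thesis .
      qed
      moreover have "norm (mprod Ns *v (x - Y (mat 1) *v x))
          \<le> C1 * (1 + real (length Ns)) ^ k * norm (x - Y (mat 1) *v x)"
        using dW[of "[]" x] x Nil by (intro C1(2)) auto
      ultimately show ?case
        using mult_left_mono[of "norm (x - Y (mat 1) *v x)" "D * norm x" "C1 * (1 + real (length Ns)) ^ k"] C1(1)
        by simp
    next
      case (Cons M Ms)
      then have M: "M \<in> \<Sigma>" and Ms: "Ms \<in> lists \<Sigma>" and Ns: "Ns \<in> lists \<Sigma>"
        and MMs: "M # Ms \<in> lists \<Sigma>" by auto
      let ?P = "mprod Ms" and ?d = "mprod Ms *v x - Y (mprod Ms) *v x"
      define e where "e = M *v (Y ?P *v x) - Y (M ** ?P) *v x"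
      have split: "mprod (M # Ms) *v x - Y (mprod (M # Ms)) *v x = M *v ?d + e"
        by (simp add: e_def matrix_vector_mult_diff_distrib matrix_vector_mul_assoc)
      have "M *v ?d \<in> W" using Winv dW[OF Ms x] M \<Sigma>(1) by blast
      moreover have "mprod (M # Ms) *v x - Y (mprod (M # Ms)) *v x \<in> W" using dW[OF MMs x] .
      ultimately have eW: "e \<in> W" using subspace_diff[OF sW] unfolding split by fastforce
      have MP: "M ** ?P \<in> G" using GP[OF MMs] by simp
      have "norm e \<le> norm (M *v (Y ?P *v x)) + norm (Y (M ** ?P) *v x)"
        unfolding e_def by (rule norm_triangle_ineq4)
      also have "\<dots> \<le> b * (C2 * norm x) + C2 * norm x"
        using \<Sigma>(2)[OF M, of "Y ?P *v x"] mult_left_mono[OF Yx[OF GP[OF Ms], of x] b] Yx[OF MP, of x] by linarith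
      also have "\<dots> = (b * C2 + C2) * norm x" by (simp add: algebra_simps)
      also have "\<dots> \<le> D * norm x" using D(2) by (intro mult_right_mono) auto
      finally have ne: "norm e \<le> D * norm x" .
      let ?t = "C1 * (1 + real (length Ns) + real (length (M # Ms))) ^ k * (D * norm x)"
      have "norm (mprod Ns *v e) \<le> C1 * (1 + real (length Ns)) ^ k * norm e"
        using Ns eW by (intro C1(2))
      also have "\<dots> \<le> C1 * (1 + real (length Ns)) ^ k * (D * norm x)"
        using ne C1(1) by (intro mult_left_mono) auto
      also have "\<dots> \<le> ?t"
        using C1(1) D(3) by (intro mult_right_mono mult_left_mono power_mono) auto
      finally have 1: "norm (mprod Ns *v e) \<le> ?t" .
      have e1: "mprod (Ns @ [M]) *v ?d = mprod Ns *v (M *v ?d)"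
        by (simp add: mprod_append matrix_vector_mul_assoc matrix_mul_assoc)
      have e2: "1 + real (length (Ns @ [M])) + real (length Ms) = 1 + real (length Ns) + real (length (M # Ms))"
        by simp
      have "norm (mprod (Ns @ [M]) *v ?d)
          \<le> (1 + real (length Ms)) * (C1 * (1 + real (length (Ns @ [M])) + real (length Ms)) ^ k * (D * norm x))"
        using Cons.IH[of "Ns @ [M]"] Ns M by auto
      then have 2: "norm (mprod Ns *v (M *v ?d)) \<le> (1 + real (length Ms)) * ?t"
        unfolding e1 e2 .
      have "norm (mprod Ns *v (M *v ?d + e)) \<le> norm (mprod Ns *v (M *v ?d)) + norm (mprod Ns *v e)"
        unfolding matrix_vector_right_distrib by (rule norm_triangle_ineq)
      also have "\<dots> \<le> (1 + real (length (M # Ms))) * ?t" using 1 2 by (simp add: algebra_simps)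
      finally show ?case unfolding split .
    qed
    have "norm (mprod Ms *v x) \<le> (C2 + C1 * D) * (1 + real (length Ms)) ^ Suc k * norm x"
      if Ms: "Ms \<in> lists \<Sigma>" and x: "x \<in> V" for Ms x
    proof -
      let ?l = "1 + real (length Ms)"
      have "norm (mprod Ms *v x) \<le> norm (Y (mprod Ms) *v x) + norm (mprod Ms *v x - Y (mprod Ms) *v x)"
        by (metis add.commute diff_add_cancel norm_triangle_ineq)
      also have "\<dots> \<le> C2 * norm x + ?l * (C1 * ?l ^ k * (D * norm x))"
        using Yx[OF GP[OF Ms], of x] step[OF Ms _ x, of "[]"] by simp
      also have "C2 * norm x \<le> C2 * norm x * ?l ^ Suc k"
        using mult_left_mono[OF one_le_power[of ?l "Suc k"], of "C2 * norm x"] C2(1) by simp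
      also have "C2 * norm x * ?l ^ Suc k + ?l * (C1 * ?l ^ k * (D * norm x))
          = (C2 + C1 * D) * ?l ^ Suc k * norm x"
        by (simp add: algebra_simps)
      finally show ?thesis by simp
    qed
    moreover have "0 \<le> C2 + C1 * D" using C1(1) C2(1) D(3) by simp
    ultimately show ?thesis by blast
  qed
qed

end

text \<open>A quantitative form of the Berger-Wang theorem: bounded traces of all products, which hold as soon as
all spectral radii are at most \<open>1\<close>, force polynomial growth of the products.\<close>

lemma polynomial_growth_of_products:
  fixes \<Sigma> :: "(real^'n^'n) set"
  assumes tr: "\<And>Ms. Ms \<in> lists \<Sigma> \<Longrightarrow> \<bar>trace (mprod Ms)\<bar> \<le> c"
    and b: "\<And>M x. M \<in> \<Sigma> \<Longrightarrow> norm (M *v x) \<le> b * norm x" "0 \<le> b"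
  obtains C k where "0 \<le> C" "\<And>Ms x. Ms \<in> lists \<Sigma> \<Longrightarrow>
    norm (mprod Ms *v x) \<le> C * (1 + real (length Ms)) ^ k * norm x"
proof -
  let ?G = "mprod ` lists \<Sigma>"
  interpret matrix_monoid ?G
  proof
    show "mat 1 \<in> ?G" by (rule image_eqI[of _ _ "[]"]) auto
    fix M N assume "M \<in> ?G" "N \<in> ?G"
    then obtain Ms Ns where "M = mprod Ms" "N = mprod Ns" "Ms \<in> lists \<Sigma>" "Ns \<in> lists \<Sigma>" by blast
    then show "M ** N \<in> ?G" by (intro image_eqI[of _ _ "Ms @ Ns"]) (auto simp: mprod_append)
  qed
  have "\<Sigma> \<subseteq> ?G"
  proof
    fix M assume "M \<in> \<Sigma>"
    then show "M \<in> ?G" by (intro image_eqI[of _ _ "[M]"]) auto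
  qed
  have "\<bar>trace M\<bar> \<le> c" if "M \<in> ?G" for M using tr that by auto
  from growth_on_invariant_subspace[OF this \<open>\<Sigma> \<subseteq> ?G\<close> b subspace_UNIV]
  have "\<exists>C k. 0 \<le> C \<and> (\<forall>Ms\<in>lists \<Sigma>. \<forall>x\<in>UNIV.
      norm (mprod Ms *v x) \<le> C * (1 + real (length Ms)) ^ k * norm x)" by simp
  with that show ?thesis by blast
qed

section \<open>Analytic dependence of a flow on its time scale\<close>

lemma cmat_mult: "cmat (A ** B) = cmat A ** cmat B"
  by (simp add: cmat_def matrix_matrix_mult_def Finite_Cartesian_Product.vec_eq_iff)

lemma cmat_one: "cmat (mat 1) = mat 1"
  by (simp add: cmat_def Finite_Cartesian_Product.mat_def Finite_Cartesian_Product.vec_eq_iff)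

text \<open>The continuation of the exponential, and then of flows, to complex time.\<close>

definition cmexp :: "real^'n^'n \<Rightarrow> complex \<Rightarrow> complex^'n^'n" where
  "cmexp A z = (\<chi> i j. \<Sum>k. of_real (mpow A k $ i $ j / fact k) * z ^ k)"

lemma cmexp_of_real: "cmexp A (of_real t) = cmat (mexp A t)"
proof -
  have "(\<Sum>k. of_real (mpow A k $ i $ j / fact k) * of_real t ^ k)
      = (of_real (\<Sum>k. mpow A k $ i $ j / fact k * t ^ k) :: complex)" for i j
  proof -
    have "complex_of_real (\<Sum>k. mpow A k $ i $ j / fact k * t ^ k)
        = (\<Sum>k. complex_of_real (mpow A k $ i $ j / fact k * t ^ k))"
      by (rule suminf_of_real[OF summable_mexp_entry_real])
    then show ?thesis by simp
  qed
  then show ?thesis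
    by (simp add: cmexp_def cmat_def mexp_def Finite_Cartesian_Product.vec_eq_iff)
qed

lemma cmexp_holomorphic: "(\<lambda>z. cmexp A (c * z) $ i $ j) holomorphic_on UNIV"
proof -
  let ?f = "\<lambda>z. \<Sum>k. of_real (mpow A k $ i $ j / fact k) * z ^ k :: complex"
  have f: "(?f has_field_derivative (\<Sum>k. diffs (\<lambda>k. of_real (mpow A k $ i $ j / fact k)) k * z ^ k)) (at z)" for z
    by (rule termdiffs_strong_converges_everywhere) (rule summable_mexp_entry)
  have "((\<lambda>z. ?f (c * z)) has_field_derivative
      (\<Sum>k. diffs (\<lambda>k. of_real (mpow A k $ i $ j / fact k)) k * (c * z) ^ k) * c) (at z)" for z
    by (rule DERIV_chain2[OF f]) (auto intro!: derivative_eq_intros)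
  then have "(\<lambda>z. ?f (c * z)) holomorphic_on UNIV"
    unfolding holomorphic_on_def field_differentiable_def by blast
  then show ?thesis by (simp add: cmexp_def)
qed

primrec cflow :: "'n::finite word \<Rightarrow> complex \<Rightarrow> complex^'n^'n" where
  "cflow [] z = mat 1"
| "cflow (p # w) z = cmexp (snd p) (of_real (fst p) * z) ** cflow w z"

text \<open>Stretching all pieces by a common factor at least \<open>1\<close> respects every dwell time; this is the only
perturbation of words that is used.\<close>

definition scale_word :: "real \<Rightarrow> 'n::finite word \<Rightarrow> 'n word" where
  "scale_word s w = map (\<lambda>p. (s * fst p, snd p)) w"

lemma scale_word_simps [simp]:
  "scale_word s [] = []" "scale_word s (p # w) = (s * fst p, snd p) # scale_word s w"
  by (simp_all add: scale_word_def)

lemma scale_word_one: "scale_word 1 w = w"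
  by (induction w) auto

lemma duration_scale_word: "duration (scale_word s w) = s * duration w"
  by (induction w) (auto simp: algebra_simps)

lemma scale_word_in_words:
  assumes "w \<in> words S \<tau>" "1 \<le> s" "0 \<le> \<tau>"
  shows "scale_word s w \<in> words S \<tau>"
  using assms(1)
proof (induction w)
  case (Cons p w)
  have "1 * fst p \<le> s * fst p" using Cons.prems assms by (intro mult_right_mono) auto
  then show ?case using Cons by auto
qed simp

lemma cflow_of_real: "cflow w (of_real s) = cmat (flow (scale_word s w))"
proof (induction w)
  case (Cons p w)
  have "cmexp (snd p) (of_real (fst p) * of_real s) = cmat (mexp (snd p) (s * fst p))"
    using cmexp_of_real[of "snd p" "s * fst p"] by (simp add: mult.commute)
  with Cons show ?case by (simp add: cmat_mult)
qed (simp add: cmat_one)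

lemma cflow_zero: "cflow w 0 = mat 1"
proof -
  have "flow (scale_word 0 w) = mat 1" by (induction w) auto
  then show ?thesis using cflow_of_real[of w 0] by (simp add: cmat_one)
qed

lemma cflow_holomorphic: "(\<lambda>z. cflow w z $ i $ j) holomorphic_on UNIV"
proof (induction w arbitrary: i j)
  case (Cons p w)
  then show ?case
    by (auto simp: matrix_matrix_mult_def intro!: holomorphic_intros cmexp_holomorphic)
qed simp

lemma continuous_on_flow_scale: "continuous_on S (\<lambda>s. flow (scale_word s w))"
  by (induction w) (auto intro!: continuous_on_matrix_mult continuous_on_mexp_comp continuous_intros)

section \<open>The angles of the eigenvalues are not rigid\<close>

text \<open>The matrix of the Sylvester operator \<open>X \<mapsto> F X - c X F\<close> with respect to the matrix units.\<close>

definition sylvester :: "complex \<Rightarrow> complex^'n^'n \<Rightarrow> complex^('n \<times> 'n)^('n \<times> 'n)" where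
  "sylvester c F = (\<chi> p q. (if snd p = snd q then F $ fst p $ fst q else 0)
     - c * (if fst p = fst q then F $ snd q $ snd p else 0))"

lemma sylvester_det_holomorphic:
  assumes "\<And>i j. (\<lambda>z. F z $ i $ j) holomorphic_on UNIV"
  shows "(\<lambda>z. det (sylvester c (F z))) holomorphic_on UNIV"
proof -
  have "(\<lambda>z. sylvester c (F z) $ p $ q) holomorphic_on UNIV" for p q
    by (cases "snd p = snd q"; cases "fst p = fst q")
      (auto simp: sylvester_def intro!: holomorphic_intros assms)
  then show ?thesis unfolding Determinants.det_def by (intro holomorphic_intros)
qed

lemma sylvester_one_det:
  assumes "c \<noteq> 1" shows "det (sylvester c (mat 1 :: complex^'n^'n)) \<noteq> 0"
proof -
  have e: "sylvester c (mat 1 :: complex^'n^'n) $ p $ q = (if p = q then 1 - c else 0)" for p q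
    by (cases p; cases q) (auto simp: sylvester_def Finite_Cartesian_Product.mat_def)
  have "det (sylvester c (mat 1 :: complex^'n^'n)) = (\<Prod>p\<in>(UNIV :: ('n \<times> 'n) set). 1 - c)"
    by (subst det_diagonal) (auto simp: e)
  then show ?thesis using assms by simp
qed

text \<open>The rank one matrix \<open>v w\<^sup>T\<close> is in the kernel of the operator.\<close>

lemma sylvester_singular:
  fixes F :: "complex^'n^'n"
  assumes v: "v \<noteq> 0" "F *v v = (c * z) *s v" and w: "w \<noteq> 0" "transpose F *v w = z *s w"
  shows "det (sylvester c F) = 0"
proof (rule ccontr)
  assume "det (sylvester c F) \<noteq> 0"
  then obtain B where B: "B ** sylvester c F = mat 1"
    using invertible_det_nz[of "sylvester c F"] unfolding invertible_def by blast
  define X :: "complex^('n \<times> 'n)" where "X = (\<chi> p. v $ fst p * w $ snd p)"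
  have "(sylvester c F *v X) $ (i, j) = 0" for i j
  proof -
    have "(sylvester c F *v X) $ (i, j)
        = (\<Sum>k\<in>UNIV. \<Sum>l\<in>UNIV. sylvester c F $ (i, j) $ (k, l) * X $ (k, l))"
      by (simp add: matrix_vector_mult_def sum.cartesian_product flip: UNIV_Times_UNIV)
    also have "\<dots> = (\<Sum>k\<in>UNIV. \<Sum>l\<in>UNIV. (if j = l then F $ i $ k * (v $ k * w $ l) else 0))
        - (\<Sum>k\<in>UNIV. \<Sum>l\<in>UNIV. (if i = k then c * (F $ l $ j * (v $ k * w $ l)) else 0))"
      unfolding sum_subtractf[symmetric]
      by (intro sum.cong refl) (auto simp: sylvester_def X_def algebra_simps)
    also have "(\<Sum>k\<in>UNIV. \<Sum>l\<in>UNIV. (if i = k then c * (F $ l $ j * (v $ k * w $ l)) else 0))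
        = (\<Sum>l\<in>UNIV. \<Sum>k\<in>UNIV. (if i = k then c * (F $ l $ j * (v $ k * w $ l)) else 0))"
      by (rule sum.swap)
    also have "(\<Sum>k\<in>UNIV. \<Sum>l\<in>UNIV. (if j = l then F $ i $ k * (v $ k * w $ l) else 0))
        = (F *v v) $ i * w $ j"
      by (simp add: matrix_vector_mult_def sum_distrib_right mult.assoc)
    also have "(\<Sum>l\<in>UNIV. \<Sum>k\<in>UNIV. (if i = k then c * (F $ l $ j * (v $ k * w $ l)) else 0))
        = c * v $ i * (transpose F *v w) $ j"
      by (simp add: matrix_vector_mult_def transpose_def sum_distrib_left mult_ac)
    finally show ?thesis unfolding v w by simp
  qed
  then have "sylvester c F *v X = 0" by (auto simp: Finite_Cartesian_Product.vec_eq_iff)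
  then have "X = 0" using matrix_vector_mul_assoc[of B "sylvester c F" X] B by simp
  moreover obtain i j where "v $ i \<noteq> 0" "w $ j \<noteq> 0"
    using v(1) w(1) by (auto simp: Finite_Cartesian_Product.vec_eq_iff)
  then have "X $ (i, j) \<noteq> 0" by (simp add: X_def)
  ultimately show False by simp
qed

lemma charpoly_root_cnj:
  assumes "poly (charpoly A) z = 0" shows "poly (charpoly A) (cnj z) = 0"
proof -
  obtain v where v: "v \<noteq> 0" "cmat A *v v = z *s v" using assms unfolding charpoly_root_iff by blast
  define u where "u = (\<chi> i. cnj (v $ i))"
  have "u \<noteq> 0" using v(1) by (auto simp: u_def Finite_Cartesian_Product.vec_eq_iff)
  moreover have "(cmat A *v u) $ i = (cnj z *s u) $ i" for i
  proof -
    have "(cmat A *v u) $ i = cnj ((cmat A *v v) $ i)"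
      by (simp add: matrix_vector_mult_def cmat_def u_def)
    then show ?thesis unfolding v(2) by (simp add: u_def)
  qed
  ultimately show ?thesis unfolding charpoly_root_iff Finite_Cartesian_Product.vec_eq_iff by blast
qed

text \<open>If \<open>r u\<close> is an eigenvalue of the real matrix \<open>F\<close>, so is its conjugate, and the first is \<open>u\<^sup>2\<close>
times the second; hence the Sylvester operator with \<open>c = u\<^sup>2\<close> is singular.  Its determinant is an entire function
of the time scale.  It vanishes on an interval, so it vanishes at the scale \<open>0\<close>, where \<open>F\<close> is the
identity and the operator is multiplication by \<open>1 - u\<^sup>2\<close>.\<close>

lemma constant_angle_is_real:
  fixes w :: "'n::finite word"
  assumes ab: "a < b" and u: "norm u = 1"
    and ev: "\<And>s. s \<in> {a<..<b} \<Longrightarrow> \<exists>r. poly (charpoly (flow (scale_word s w))) (of_real r * u) = 0"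
  shows "u ^ 2 = 1"
proof (rule ccontr)
  assume u2: "u ^ 2 \<noteq> 1"
  let ?f = "\<lambda>z. det (sylvester (u ^ 2) (cflow w z))"
  obtain m where m: "a < m" "m < b" using dense[OF ab] by blast
  have uu: "u * cnj u = 1" using complex_norm_square[of u] u by simp
  have zero: "?f z = 0" if zin: "z \<in> complex_of_real ` {a<..<b}" for z
  proof -
    obtain s where s: "s \<in> {a<..<b}" "z = of_real s" using zin by blast
    let ?M = "flow (scale_word s w)"
    obtain r where r: "poly (charpoly ?M) (of_real r * u) = 0" using ev[OF s(1)] by blast
    obtain v where v: "v \<noteq> 0" "cmat ?M *v v = (of_real r * u) *s v"
      using r unfolding charpoly_root_iff by blast
    have "poly (charpoly (transpose ?M)) (cnj (of_real r * u)) = 0"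
      using charpoly_root_cnj[OF r] by (simp add: charpoly_transpose)
    then obtain y where y: "y \<noteq> 0" "cmat (transpose ?M) *v y = cnj (of_real r * u) *s y"
      unfolding charpoly_root_iff by blast
    have "u ^ 2 * cnj (of_real r * u) = of_real r * u * (u * cnj u)"
      by (simp add: power2_eq_square mult_ac)
    then have "u ^ 2 * cnj (of_real r * u) = of_real r * u" by (simp add: uu)
    moreover have "cmat (transpose ?M) = transpose (cmat ?M)" by (simp add: cmat_def transpose_def)
    ultimately have "det (sylvester (u ^ 2) (cmat ?M)) = 0"
      using sylvester_singular[of v "cmat ?M" "u ^ 2" "cnj (of_real r * u)" y] v y by metis
    then show ?thesis unfolding s(2) cflow_of_real .
  qed
  have lim: "complex_of_real m islimpt complex_of_real ` {a<..<b}"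
    unfolding islimpt_approachable
  proof (intro allI impI)
    fix e :: real assume "0 < e"
    then have "m < min (m + e) b" using m by simp
    then obtain y where y: "m < y" "y < m + e" "y < b" using dense by (metis min_less_iff_conj)
    show "\<exists>x'\<in>complex_of_real ` {a<..<b}. x' \<noteq> complex_of_real m \<and> dist x' (complex_of_real m) < e"
    proof (intro bexI conjI)
      show "complex_of_real y \<in> complex_of_real ` {a<..<b}" using y m by (intro imageI) simp
    qed (use y in \<open>simp_all add: dist_of_real dist_real_def\<close>)
  qed
  have "?f 0 = 0"
    by (rule analytic_continuation[where f="?f" and S=UNIV, OF sylvester_det_holomorphic[OF cflow_holomorphic]
          open_UNIV connected_UNIV subset_UNIV UNIV_I lim zero UNIV_I])
  then show False using sylvester_one_det[OF u2, where 'n='n] by (simp add: cflow_zero)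
qed

section \<open>Continuous branches of eigenvalues\<close>

lemma norm_prod_list_ge:
  fixes w :: complex
  assumes "0 \<le> \<delta>" "\<And>z. z \<in> set zs \<Longrightarrow> \<delta> \<le> norm (w - z)"
  shows "\<delta> ^ length zs \<le> norm (\<Prod>z\<leftarrow>zs. w - z)"
  using assms(2)
proof (induction zs)
  case (Cons z zs)
  then have "\<delta> * \<delta> ^ length zs \<le> norm (w - z) * norm (\<Prod>z\<leftarrow>zs. w - z)"
    using assms(1) by (intro mult_mono) auto
  then show ?case by (simp add: norm_mult)
qed simp

text \<open>The modulus of the characteristic polynomial at \<open>z\<close> is the product of the distances from \<open>z\<close> to the
eigenvalues; if it is small, one of these is small.\<close>

lemma eigenvalue_lower_semicontinuous:
  fixes M :: "real \<Rightarrow> real^'n^'n"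
  assumes cont: "continuous_on UNIV M" and z: "poly (charpoly (M s)) z = 0" and \<delta>: "0 < \<delta>"
  shows "\<forall>\<^sub>F t in nhds s. \<exists>y. poly (charpoly (M t)) y = 0 \<and> dist y z < \<delta>"
proof -
  have "continuous_on UNIV (\<lambda>t. poly (charpoly (M t)) z)" by (rule continuous_on_poly_charpoly[OF cont])
  then have "isCont (\<lambda>t. poly (charpoly (M t)) z) s"
    unfolding continuous_on_eq_continuous_at[OF open_UNIV] by blast
  then have "((\<lambda>t. poly (charpoly (M t)) z) \<longlongrightarrow> 0) (nhds s)"
    using tendsto_at_iff_tendsto_nhds[of "\<lambda>t. poly (charpoly (M t)) z" s] unfolding isCont_def z by blast
  then have "\<forall>\<^sub>F t in nhds s. dist (poly (charpoly (M t)) z) 0 < \<delta> ^ CARD('n)"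
    by (rule tendstoD) (use \<delta> in simp)
  then show ?thesis
  proof (rule eventually_mono)
    fix t assume t: "dist (poly (charpoly (M t)) z) 0 < \<delta> ^ CARD('n)"
    obtain zs where zs: "length zs = CARD('n)" "charpoly (M t) = (\<Prod>z\<leftarrow>zs. [:- z, 1:])"
      using charpoly_eigenvalues[of "M t"] by metis
    have "\<exists>y\<in>set zs. norm (z - y) < \<delta>"
    proof (rule ccontr)
      assume "\<not> ?thesis"
      then have "\<delta> ^ length zs \<le> norm (\<Prod>y\<leftarrow>zs. z - y)"
        using \<delta> by (intro norm_prod_list_ge) auto
      then show False using t by (simp add: zs poly_linear_factors_root)
    qed
    then obtain y where "y \<in> set zs" "norm (z - y) < \<delta>" by blast
    then show "\<exists>y. poly (charpoly (M t)) y = 0 \<and> dist y z < \<delta>"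
      by (intro exI[of _ y]) (auto simp: zs poly_linear_factors_root prod_list_zero_iff dist_norm norm_minus_commute)
  qed
qed

lemma eigenvalues_finite:
  fixes A :: "real^'n^'n"
  shows "finite {z. poly (charpoly A) z = 0}" "card {z. poly (charpoly A) z = 0} \<le> CARD('n)"
proof -
  obtain zs where zs: "length zs = CARD('n)" "charpoly A = (\<Prod>z\<leftarrow>zs. [:- z, 1:])"
    using charpoly_eigenvalues[of A] by metis
  have "{z. poly (charpoly A) z = 0} = set zs"
    by (auto simp: zs poly_linear_factors_root prod_list_zero_iff)
  then show "finite {z. poly (charpoly A) z = 0}" "card {z. poly (charpoly A) z = 0} \<le> CARD('n)"
    using card_length[of zs] zs(1) by auto
qed

lemma finite_separated:
  fixes F :: "'a::metric_space set"
  assumes "finite F"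
  obtains d where "0 < d" "\<And>x y. x \<in> F \<Longrightarrow> y \<in> F \<Longrightarrow> x \<noteq> y \<Longrightarrow> d \<le> dist x y"
proof -
  have "\<exists>d>0. \<forall>x\<in>F. \<forall>y\<in>F. x \<noteq> y \<longrightarrow> d \<le> dist x y"
  proof (cases "\<exists>x\<in>F. \<exists>y\<in>F. x \<noteq> y")
    case True
    let ?D = "{dist x y | x y. x \<in> F \<and> y \<in> F \<and> x \<noteq> y}"
    have fin: "finite ?D"
      by (rule finite_subset[of _ "(\<lambda>(x, y). dist x y) ` (F \<times> F)"]) (use assms in auto)
    have "?D \<noteq> {}" using True by blast
    then have "Min ?D \<in> ?D" by (rule Min_in[OF fin])
    then have "0 < Min ?D" by auto
    moreover have "Min ?D \<le> dist x y" if "x \<in> F" "y \<in> F" "x \<noteq> y" for x y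
      by (rule Min_le[OF fin]) (use that in blast)
    ultimately show ?thesis by blast
  qed (auto intro: exI[of _ 1])
  with that show ?thesis by blast
qed

text \<open>Choose a parameter \<open>s1\<close> at which the number of points is maximal.  By lower semicontinuity every
nearby set has a point in each of the disjoint small discs around the points at \<open>s1\<close>, and by maximality
exactly one; the point in a given disc then varies continuously, again by lower semicontinuity.\<close>

lemma continuous_branch_exists:
  fixes Z :: "real \<Rightarrow> complex set"
  assumes ab: "a < b" and fin: "\<And>s. finite (Z s)" "\<And>s. card (Z s) \<le> N"
    and lsc: "\<And>s z \<delta>. z \<in> Z s \<Longrightarrow> 0 < \<delta> \<Longrightarrow> \<forall>\<^sub>F t in nhds s. \<exists>y\<in>Z t. dist y z < \<delta>"
    and O: "open W" "\<And>s. s \<in> {a<..<b} \<Longrightarrow> Z s \<inter> W \<noteq> {}"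
  shows "\<exists>a' b' \<zeta>. a \<le> a' \<and> a' < b' \<and> b' \<le> b \<and> continuous_on {a'<..<b'} \<zeta> \<and>
    (\<forall>s\<in>{a'<..<b'}. \<zeta> s \<in> Z s \<inter> W)"
proof -
  obtain s1 where s1: "s1 \<in> {a<..<b}" "\<And>s. s \<in> {a<..<b} \<Longrightarrow> card (Z s) \<le> card (Z s1)"
    using ex_has_greatest_nat[of "\<lambda>s. s \<in> {a<..<b}" "(a + b) / 2" "\<lambda>s. card (Z s)" "Suc N"] ab fin(2)
    by (auto simp: less_Suc_eq_le)
  obtain z1 where z1: "z1 \<in> Z s1" "z1 \<in> W" using O(2)[OF s1(1)] by blast
  obtain d where d: "0 < d" "\<And>x y. x \<in> Z s1 \<Longrightarrow> y \<in> Z s1 \<Longrightarrow> x \<noteq> y \<Longrightarrow> d \<le> dist x y"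
    using finite_separated[OF fin(1)] by blast
  obtain d' where d': "0 < d'" "ball z1 d' \<subseteq> W" using O(1) z1(2) open_contains_ball by blast
  \<comment> \<open>discs of radius at most half the separation are disjoint\<close>
  define \<delta> where "\<delta> = min (d / 2) d'"
  have \<delta>: "0 < \<delta>" "ball z1 \<delta> \<subseteq> W" using d d' by (auto simp: \<delta>_def)
  have sep: "x = y" if "x \<in> Z s1" "y \<in> Z s1" "dist p x < \<delta>" "dist p y < \<delta>" for x y p
  proof (rule ccontr)
    assume "x \<noteq> y"
    then have "d \<le> dist x y" using d(2) that by blast
    also have "\<dots> \<le> dist p x + dist p y" by (metis dist_commute dist_triangle)
    also have "\<dots> < d" using that(3,4) by (simp add: \<delta>_def)
    finally show False by simp
  qed
  have "\<forall>\<^sub>F t in nhds s1. \<forall>z\<in>Z s1. \<exists>y\<in>Z t. dist y z < \<delta>"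
    using lsc[OF _ \<delta>(1)] by (intro eventually_ball_finite fin) blast
  moreover have "\<forall>\<^sub>F t in nhds s1. t \<in> {a<..<b}"
    using s1(1) by (intro eventually_nhds_in_open) auto
  ultimately have "\<forall>\<^sub>F t in nhds s1. t \<in> {a<..<b} \<and> (\<forall>z\<in>Z s1. \<exists>y\<in>Z t. dist y z < \<delta>)"
    by eventually_elim auto
  then obtain e where e: "0 < e"
    "\<And>t. dist t s1 < e \<Longrightarrow> t \<in> {a<..<b} \<and> (\<forall>z\<in>Z s1. \<exists>y\<in>Z t. dist y z < \<delta>)"
    unfolding eventually_nhds_metric by blast
  have inJ: "dist t s1 < e \<longleftrightarrow> t \<in> {s1 - e<..<s1 + e}" for t by (auto simp: dist_real_def abs_less_iff)
  have uniq: "p = q" if t: "dist t s1 < e" and "p \<in> Z t" "q \<in> Z t" "dist p z1 < \<delta>" "dist q z1 < \<delta>" for t p q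
  proof -
    obtain f where f: "\<And>z. z \<in> Z s1 \<Longrightarrow> f z \<in> Z t \<and> dist (f z) z < \<delta>" using e(2)[OF t] by metis
    have "inj_on f (Z s1)"
    proof (rule inj_onI)
      fix x y assume "x \<in> Z s1" "y \<in> Z s1" "f x = f y"
      then show "x = y" using f[of x] f[of y] sep[of x y "f x"] by simp
    qed
    then have "card (f ` Z s1) = card (Z s1)" by (rule card_image)
    moreover have "f ` Z s1 \<subseteq> Z t" using f by blast
    ultimately have surj: "f ` Z s1 = Z t"
      using card_subset_eq[OF fin(1)] card_mono[OF fin(1)] s1(2)[of t] e(2)[OF t] by (metis le_antisym)
    have "p = f z1" if p: "p \<in> Z t" "dist p z1 < \<delta>" for p
    proof -
      obtain y where y: "y \<in> Z s1" "p = f y" using p(1) surj by blast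
      then show ?thesis using f[OF y(1)] sep[OF y(1) z1(1), of p] p(2) by simp
    qed
    then show ?thesis using that by blast
  qed
  define \<zeta> where "\<zeta> t = (SOME p. p \<in> Z t \<and> dist p z1 < \<delta>)" for t
  have \<zeta>: "\<zeta> t \<in> Z t" "dist (\<zeta> t) z1 < \<delta>" if "dist t s1 < e" for t
  proof -
    have "\<exists>p. p \<in> Z t \<and> dist p z1 < \<delta>" using e(2)[OF that] z1(1) by blast
    from someI_ex[OF this] show "\<zeta> t \<in> Z t" "dist (\<zeta> t) z1 < \<delta>" unfolding \<zeta>_def by auto
  qed
  have "isCont \<zeta> t" if t: "dist t s1 < e" for t
    unfolding isCont_def
  proof (rule tendstoI)
    fix \<epsilon> :: real assume "0 < \<epsilon>"
    \<comment> \<open>small enough that a point this close to \<open>\<zeta> t\<close> stays in the disc around \<open>z1\<close>\<close>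
    define \<eta> where "\<eta> = min \<epsilon> (\<delta> - dist (\<zeta> t) z1)"
    have "0 < \<eta>" using \<zeta>(2)[OF t] \<open>0 < \<epsilon>\<close> by (simp add: \<eta>_def)
    from lsc[OF \<zeta>(1)[OF t] this] have 1: "\<forall>\<^sub>F x in nhds t. \<exists>y\<in>Z x. dist y (\<zeta> t) < \<eta>" .
    have "\<forall>\<^sub>F x in nhds t. x \<in> {s1 - e<..<s1 + e}"
      using t inJ by (intro eventually_nhds_in_open) auto
    with 1 have "\<forall>\<^sub>F x in nhds t. dist (\<zeta> x) (\<zeta> t) < \<epsilon>"
    proof eventually_elim
      case (elim x)
      then obtain y where y: "y \<in> Z x" "dist y (\<zeta> t) < \<eta>" by blast
      have x: "dist x s1 < e" using elim(2) inJ by blast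
      have "dist y z1 \<le> dist y (\<zeta> t) + dist (\<zeta> t) z1" by (rule dist_triangle)
      also have "\<dots> < \<delta>" using y(2) by (simp add: \<eta>_def)
      finally have "y = \<zeta> x" using uniq[OF x y(1) \<zeta>(1)[OF x] _ \<zeta>(2)[OF x]] by blast
      then show ?case using y(2) by (simp add: \<eta>_def)
    qed
    then show "\<forall>\<^sub>F x in at t. dist (\<zeta> x) (\<zeta> t) < \<epsilon>"
      unfolding eventually_at_filter by (rule eventually_mono) simp
  qed
  then have "continuous_on {s1 - e<..<s1 + e} \<zeta>"
    using inJ by (intro continuous_at_imp_continuous_on) blast
  moreover have "a \<le> s1 - e"
  proof (rule ccontr)
    assume "\<not> a \<le> s1 - e"
    then have "dist a s1 < e" using s1(1) by (auto simp: dist_real_def)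
    then show False using e(2)[of a] by auto
  qed
  moreover have "s1 + e \<le> b"
  proof (rule ccontr)
    assume "\<not> s1 + e \<le> b"
    then have "dist b s1 < e" using s1(1) by (auto simp: dist_real_def)
    then show False using e(2)[of b] by auto
  qed
  moreover have "\<zeta> s \<in> Z s \<inter> W" if "s \<in> {s1 - e<..<s1 + e}" for s
    using \<zeta>[of s] that inJ[of s] \<delta>(2) by (auto simp: dist_commute)
  moreover have "s1 - e < s1 + e" using e(1) by simp
  ultimately show ?thesis by blast
qed

lemma rational_angle_between:
  assumes "- 1 \<le> x" "x < y" "y \<le> (1::real)"
  obtains m :: int and n :: nat where "0 < n" "x < cos (pi * m / n)" "cos (pi * m / n) < y"
proof -
  have "arccos y < arccos x" using assms by (intro arccos_less_mono[THEN iffD2]) auto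
  then have "arccos y / pi < arccos x / pi" by (simp add: divide_strict_right_mono)
  then obtain r where r: "r \<in> \<rat>" "arccos y / pi < r" "r < arccos x / pi"
    using Rats_dense_in_real by blast
  obtain m :: int and n :: nat where mn: "0 < n" "r = of_int m / of_nat n"
    using r(1) by (auto elim!: Rats_cases') (metis Rats_cases' of_int_of_nat_eq pos_int_cases r(1))
  have a: "arccos y < pi * r" "pi * r < arccos x" using r(2,3) by (auto simp: field_simps)
  have p: "0 \<le> arccos y" "arccos x \<le> pi"
    using assms by (auto intro: arccos_lbound arccos_ubound)
  have "cos (arccos x) < cos (pi * r)"
    by (rule cos_monotone_0_pi[OF _ a(2) p(2)]) (use a(1) p(1) in linarith)
  moreover have "cos (pi * r) < cos (arccos y)"
    by (rule cos_monotone_0_pi[OF p(1) a(1)]) (use a(2) p(2) in linarith)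
  ultimately show ?thesis using that[of n m] assms mn by (simp add: mn)
qed

lemma root_of_unity_of_rational_angle:
  assumes "norm u = 1" "Re u = cos (pi * of_int m / of_nat n)" "0 < n"
  shows "u ^ (2 * n) = 1"
proof -
  let ?\<theta> = "pi * of_int m / of_nat n"
  have "(Re u)\<^sup>2 + (Im u)\<^sup>2 = 1" using assms(1) by (metis cmod_power2 one_power2)
  moreover have "(cos ?\<theta>)\<^sup>2 + (sin ?\<theta>)\<^sup>2 = 1" by simp
  ultimately have "(Im u)\<^sup>2 = (sin ?\<theta>)\<^sup>2" unfolding assms(2) by linarith
  then have "Im u = sin ?\<theta> \<or> Im u = - sin ?\<theta>" by (simp add: power2_eq_iff)
  then have "u = cis ?\<theta> \<or> u = cis (- ?\<theta>)" using assms(2) by (auto simp: complex_eq_iff)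
  moreover have "cis ?\<theta> ^ (2 * n) = 1"
    using assms(3) cis_multiple_2pi[of "of_int m"] unfolding Complex.DeMoivre by (simp add: mult_ac)
  moreover have "cis (- ?\<theta>) ^ (2 * n) = 1"
    using assms(3) cis_multiple_2pi[of "- of_int m"] unfolding Complex.DeMoivre by (simp add: mult_ac)
  ultimately show ?thesis by blast
qed

text \<open>If the real part of \<open>u\<close> varies, it takes the cosine of a rational multiple of \<open>\<pi>\<close> as a value, and
then \<open>u\<close> is a root of unity.  If only the imaginary part varies, it changes sign and \<open>u\<close> passes through
\<open>1\<close> or \<open>- 1\<close>.\<close>

lemma continuous_angle_dichotomy:
  fixes u :: "real \<Rightarrow> complex"
  assumes cont: "continuous_on {a<..<b} u" and n: "\<And>s. s \<in> {a<..<b} \<Longrightarrow> norm (u s) = 1"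
  shows "(\<exists>s\<in>{a<..<b}. \<exists>k>0. u s ^ k = 1) \<or> u constant_on {a<..<b}"
proof (rule disjCI)
  assume nc: "\<not> u constant_on {a<..<b}"
  then obtain s t where st: "s \<in> {a<..<b}" "t \<in> {a<..<b}" "u s \<noteq> u t"
    unfolding constant_on_def by blast
  have hit: "\<exists>x\<in>{a<..<b}. f (u x) = y"
    if "continuous_on UNIV f" "p \<in> {a<..<b}" "q \<in> {a<..<b}" "f (u p) \<le> y" "y \<le> f (u q)"
    for f :: "complex \<Rightarrow> real" and p q y
  proof -
    have "connected ((\<lambda>x. f (u x)) ` {a<..<b})"
      using continuous_on_compose2[OF that(1) cont] by (intro connected_continuous_image) auto
    then have "y \<in> (\<lambda>x. f (u x)) ` {a<..<b}"
      by (rule connectedD_interval[of _ "f (u p)" "f (u q)"]) (use that in simp_all)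
    then show ?thesis by blast
  qed
  have Re_le: "\<bar>Re (u x)\<bar> \<le> 1" if "x \<in> {a<..<b}" for x using abs_Re_le_cmod[of "u x"] n[OF that] by simp
  have main: "\<exists>s\<in>{a<..<b}. \<exists>k>0. u s ^ k = 1"
    if pq: "p \<in> {a<..<b}" "q \<in> {a<..<b}" "Re (u p) < Re (u q)" for p q
  proof -
    obtain m :: int and k :: nat where k: "0 < k" "Re (u p) < cos (pi * m / k)" "cos (pi * m / k) < Re (u q)"
      using rational_angle_between[of "Re (u p)" "Re (u q)"] pq Re_le[of p] Re_le[of q] by (metis abs_le_iff minus_le_iff)
    obtain x where x: "x \<in> {a<..<b}" "Re (u x) = cos (pi * m / k)"
      using hit[OF continuous_on_Re[OF continuous_on_id] pq(1,2), of "cos (pi * m / k)"] k by auto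
    have "u x ^ (2 * k) = 1" by (rule root_of_unity_of_rational_angle[OF n[OF x(1)] x(2) k(1)])
    then show ?thesis using x(1) k(1) by (intro bexI[of _ x] exI[of _ "2 * k"]) auto
  qed
  show "\<exists>s\<in>{a<..<b}. \<exists>k>0. u s ^ k = 1"
  proof (cases "Re (u s) = Re (u t)")
    case False
    then show ?thesis using main st by (meson linorder_neqE_linordered_idom)
  next
    case True
    have sq: "(Re (u x))\<^sup>2 + (Im (u x))\<^sup>2 = 1" if "x \<in> {a<..<b}" for x
      using n[OF that] by (metis cmod_power2 one_power2)
    have "Im (u s) \<noteq> Im (u t)" using True st(3) by (auto simp: complex_eq_iff)
    moreover have "(Im (u s))\<^sup>2 = (Im (u t))\<^sup>2" using sq[OF st(1)] sq[OF st(2)] True by simp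
    ultimately have "Im (u s) = - Im (u t)" by (simp add: power2_eq_iff)
    then have "Im (u s) \<le> 0 \<and> 0 \<le> Im (u t) \<or> Im (u t) \<le> 0 \<and> 0 \<le> Im (u s)" by linarith
    then obtain x where x: "x \<in> {a<..<b}" "Im (u x) = 0"
      using hit[OF continuous_on_Im[OF continuous_on_id] st(1,2), of 0]
        hit[OF continuous_on_Im[OF continuous_on_id] st(2,1), of 0] by auto
    have "u x ^ 2 = 1" using sq[OF x(1)] x(2) by (auto simp: complex_eq_iff power2_eq_square)
    then show ?thesis using x(1) by (intro bexI[of _ x] exI[of _ 2]) auto
  qed
qed

text \<open>A branch of large eigenvalues that is continuous in the time scale either meets a rational angle or
has a constant angle, and a constant angle is \<open>0\<close> or \<open>\<pi>\<close>.\<close>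

lemma eigenvalue_with_real_power:
  fixes w :: "'n::finite word"
  assumes z0: "poly (charpoly (flow w)) z0 = 0" "exp (\<mu> * duration w) < norm z0"
  obtains s z k where "1 \<le> s" "poly (charpoly (flow (scale_word s w))) z = 0"
    "exp (\<mu> * (s * duration w)) < norm z" "0 < k" "z ^ k = of_real (norm z ^ k)"
proof -
  define M where "M s = flow (scale_word s w)" for s
  define Z where "Z s = {z. poly (charpoly (M s)) z = 0}" for s
  have contM: "continuous_on UNIV M" unfolding M_def by (rule continuous_on_flow_scale)
  \<comment> \<open>a threshold independent of the scale, so that the branch lives in a fixed open set\<close>
  obtain c where c: "exp (\<mu> * duration w) < c" "c < norm z0" using dense[OF z0(2)] by blast
  have c0: "0 < c" using c(1) exp_gt_zero order.strict_trans by blast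
  have lsc: "\<forall>\<^sub>F t in nhds s. \<exists>y\<in>Z t. dist y z < \<delta>" if "z \<in> Z s" "0 < \<delta>" for s z \<delta>
    using eigenvalue_lower_semicontinuous[OF contM _ that(2), of s z] that(1)
    by (auto simp: Z_def elim!: eventually_mono)
  have "z0 \<in> Z 1" using z0(1) by (simp add: Z_def M_def scale_word_one)
  from lsc[OF this, of "norm z0 - c"] c(2)
  have "\<forall>\<^sub>F t in nhds 1. \<exists>y\<in>Z t. dist y z0 < norm z0 - c" by simp
  moreover have "continuous_on UNIV (\<lambda>s. exp (\<mu> * (s * duration w)))" by (intro continuous_intros)
  then have "((\<lambda>s. exp (\<mu> * (s * duration w))) \<longlongrightarrow> exp (\<mu> * (1 * duration w))) (nhds 1)"
    using tendsto_at_iff_tendsto_nhds[of "\<lambda>s. exp (\<mu> * (s * duration w))" 1]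
    unfolding continuous_on_eq_continuous_at[OF open_UNIV] isCont_def by blast
  then have "\<forall>\<^sub>F s in nhds 1. exp (\<mu> * (s * duration w)) < c"
    using c(1) by (intro order_tendstoD(2)) auto
  ultimately have "\<forall>\<^sub>F t in nhds 1. (\<exists>y\<in>Z t. dist y z0 < norm z0 - c) \<and> exp (\<mu> * (t * duration w)) < c"
    by eventually_elim auto
  then obtain e where e: "0 < e" "\<And>t. dist t 1 < e \<Longrightarrow>
      (\<exists>y\<in>Z t. dist y z0 < norm z0 - c) \<and> exp (\<mu> * (t * duration w)) < c"
    unfolding eventually_nhds_metric by blast
  have near: "dist t 1 < e" if "t \<in> {1<..<1 + e}" for t :: real using that by (auto simp: dist_real_def)
  have big: "Z t \<inter> {z. c < norm z} \<noteq> {}" if t: "t \<in> {1<..<1 + e}" for t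
  proof -
    obtain y where y: "y \<in> Z t" "dist y z0 < norm z0 - c" using e(2)[OF near[OF t]] by blast
    have "norm z0 \<le> norm y + dist y z0" by (metis dist_norm norm_minus_commute norm_triangle_sub add.commute)
    then show ?thesis using y by auto
  qed
  have op: "open {z :: complex. c < norm z}" by (intro open_Collect_less continuous_intros)
  have fin: "finite (Z s)" "card (Z s) \<le> CARD('n)" for s
    unfolding Z_def by (rule eigenvalues_finite)+
  have lt: "1 < 1 + e" using e(1) by simp
  from continuous_branch_exists[OF lt fin lsc op big]
  obtain a b \<zeta> where ab: "1 \<le> a" "a < b" "b \<le> 1 + e" and cont: "continuous_on {a<..<b} \<zeta>"
    and all: "\<forall>s\<in>{a<..<b}. \<zeta> s \<in> Z s \<inter> {z. c < norm z}"
    by metis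
  have \<zeta>: "\<zeta> s \<in> Z s \<inter> {z. c < norm z}" if "s \<in> {a<..<b}" for s using all that by (rule bspec)
  define u where "u s = \<zeta> s / of_real (norm (\<zeta> s))" for s
  have nz: "\<zeta> s \<noteq> 0" if "s \<in> {a<..<b}" for s using \<zeta>[OF that] c0 by auto
  have pol: "\<zeta> s = of_real (norm (\<zeta> s)) * u s" if "s \<in> {a<..<b}" for s
    using nz[OF that] by (simp add: u_def)
  have nu: "norm (u s) = 1" if "s \<in> {a<..<b}" for s using nz[OF that] by (simp add: u_def norm_divide)
  have contu: "continuous_on {a<..<b} u"
    unfolding u_def using nz by (intro continuous_intros cont) auto
  have "\<exists>s\<in>{a<..<b}. \<exists>k>0. u s ^ k = 1"
    using continuous_angle_dichotomy[OF contu nu]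
  proof
    assume "u constant_on {a<..<b}"
    then obtain v where v: "\<And>s. s \<in> {a<..<b} \<Longrightarrow> u s = v" unfolding constant_on_def by blast
    define m where "m = (a + b) / 2"
    have m: "m \<in> {a<..<b}" using ab(2) by (simp add: m_def)
    have "v ^ 2 = 1"
    proof (rule constant_angle_is_real[OF ab(2), where w=w])
      show "norm v = 1" using nu[OF m] v[OF m] by simp
      fix s assume s: "s \<in> {a<..<b}"
      then have "poly (charpoly (flow (scale_word s w))) (\<zeta> s) = 0" using \<zeta>[OF s] by (simp add: Z_def M_def)
      then show "\<exists>r. poly (charpoly (flow (scale_word s w))) (of_real r * v) = 0"
        using pol[OF s] v[OF s] by metis
    qed
    then show ?thesis using m v by (intro bexI[of _ m] exI[of _ 2]) auto
  qed
  then obtain s k where sk: "s \<in> {a<..<b}" "0 < k" "u s ^ k = 1" by blast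
  show ?thesis
  proof (rule that[of s "\<zeta> s" k])
    show "1 \<le> s" using sk(1) ab by auto
    show "poly (charpoly (flow (scale_word s w))) (\<zeta> s) = 0" using \<zeta>[OF sk(1)] by (simp add: Z_def M_def)
    have "exp (\<mu> * (s * duration w)) < c" using e(2)[OF near, of s] sk(1) ab by auto
    then show "exp (\<mu> * (s * duration w)) < norm (\<zeta> s)" using \<zeta>[OF sk(1)] by auto
    show "\<zeta> s ^ k = of_real (norm (\<zeta> s) ^ k)"
      by (subst pol[OF sk(1)]) (simp add: power_mult_distrib sk(3))
  qed (rule sk(2))
qed

lemma real_eigenvector_of_power:
  fixes A :: "real^'n^'n"
  assumes "poly (charpoly A) z = 0" "z ^ k = of_real r"
  obtains x where "x \<noteq> 0" "mpow A k *v x = r *\<^sub>R x"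
proof -
  obtain v where v: "v \<noteq> 0" "cmat A *v v = z *s v" using assms(1) unfolding charpoly_root_iff by blast
  have pw: "cmat (mpow A j) *v v = z ^ j *s v" for j
  proof (induction j)
    case (Suc j)
    have "cmat (mpow A (Suc j)) *v v = cmat (mpow A j) *v (z *s v)"
      by (simp add: cmat_mult matrix_vector_mul_assoc[symmetric] v(2))
    also have "\<dots> = z *s (cmat (mpow A j) *v v)"
      by (simp add: matrix_vector_mult_def Finite_Cartesian_Product.vec_eq_iff sum_distrib_left mult_ac)
    finally show ?case by (simp add: Suc vector_smult_assoc)
  qed (simp add: cmat_one)
  define x y :: "real^'n" where "x = (\<chi> i. Re (v $ i))" and "y = (\<chi> i. Im (v $ i))"
  have "(mpow A k *v x) $ i = (r *\<^sub>R x) $ i" "(mpow A k *v y) $ i = (r *\<^sub>R y) $ i" for i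
  proof -
    have e: "(cmat (mpow A k) *v v) $ i = of_real r * v $ i" using pw[of k] assms(2) by simp
    have "(mpow A k *v x) $ i = Re ((cmat (mpow A k) *v v) $ i)"
      by (simp add: matrix_vector_mult_def cmat_def x_def)
    then show "(mpow A k *v x) $ i = (r *\<^sub>R x) $ i" unfolding e by (simp add: x_def)
    have "(mpow A k *v y) $ i = Im ((cmat (mpow A k) *v v) $ i)"
      by (simp add: matrix_vector_mult_def cmat_def y_def)
    then show "(mpow A k *v y) $ i = (r *\<^sub>R y) $ i" unfolding e by (simp add: y_def)
  qed
  then have "mpow A k *v x = r *\<^sub>R x" "mpow A k *v y = r *\<^sub>R y"
    by (auto simp: Finite_Cartesian_Product.vec_eq_iff)
  moreover have "x \<noteq> 0 \<or> y \<noteq> 0"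
    using v(1) by (auto simp: x_def y_def Finite_Cartesian_Product.vec_eq_iff complex_eq_iff)
  ultimately show ?thesis using that by blast
qed

section \<open>Spectral bounds control the growth of all flows\<close>

text \<open>Pieces of length \<open>h \<ge> \<tau>\<close> are cut off as long as more than \<open>2 h\<close> remains, so that the remainder is not
shorter than \<open>\<tau>\<close> either.\<close>

lemma split_long_piece:
  assumes h: "0 < h" "\<tau> \<le> h" and a: "a \<in> S" "\<tau> \<le> l"
  shows "\<exists>w\<in>words S \<tau>. flow w = mexp a l \<and> duration w = l \<and> (\<forall>p\<in>set w. fst p \<le> 2 * h)"
proof -
  have "\<exists>w\<in>words S \<tau>. flow w = mexp a l \<and> duration w = l \<and> (\<forall>p\<in>set w. fst p \<le> 2 * h)"
    if "\<tau> \<le> l" "l \<le> real n * h" for n l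
    using that
  proof (induction n arbitrary: l)
    case 0
    then show ?case using a(1) h by (intro bexI[of _ "[(l, a)]"]) auto
  next
    case (Suc n)
    show ?case
    proof (cases "l \<le> 2 * h")
      case True
      then show ?thesis using a(1) Suc.prems by (intro bexI[of _ "[(l, a)]"]) auto
    next
      case False
      have "\<tau> \<le> l - h" "l - h \<le> real n * h" using False h Suc.prems by (auto simp: algebra_simps)
      from Suc.IH[OF this] obtain w where w: "w \<in> words S \<tau>" "flow w = mexp a (l - h)"
        "duration w = l - h" "\<forall>p\<in>set w. fst p \<le> 2 * h" by blast
      have "mexp a l = mexp a h ** mexp a (l - h)" using mexp_add[of h a "l - h"] h by simp
      then show ?thesis using w h a(1) by (intro bexI[of _ "(h, a) # w"]) auto
    qed
  qed
  moreover obtain n where "l \<le> real n * h" using reals_Archimedean3[OF h(1)] less_imp_le by blast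
  ultimately show ?thesis using a(2) by blast
qed

lemma split_long_pieces:
  assumes h: "0 < h" "\<tau> \<le> h" and "w \<in> words S \<tau>"
  shows "\<exists>v\<in>words S \<tau>. flow v = flow w \<and> duration v = duration w \<and> (\<forall>p\<in>set v. fst p \<le> 2 * h)"
  using assms(3)
proof (induction w)
  case Nil
  show ?case by (intro bexI[of _ "[]"]) auto
next
  case (Cons p w)
  then obtain v where v: "v \<in> words S \<tau>" "flow v = flow w" "duration v = duration w"
    "\<forall>p\<in>set v. fst p \<le> 2 * h" by auto
  obtain u where u: "u \<in> words S \<tau>" "flow u = mexp (snd p) (fst p)" "duration u = fst p"
    "\<forall>p\<in>set u. fst p \<le> 2 * h"
    using split_long_piece[OF h, of "snd p" S "fst p"] Cons.prems by auto
  show ?case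
  proof (intro bexI[of _ "u @ v"] conjI)
    show "flow (u @ v) = flow (p # w)" using u v by (simp add: flow_append)
    show "\<forall>p\<in>set (u @ v). fst p \<le> 2 * h" using u(4) v(4) by auto
  qed (use u v in simp_all)
qed

text \<open>Greedy grouping of pieces.  Every group except the last one in time has duration at least \<open>h\<close>, so the
number of groups is controlled by the duration even when \<open>\<tau> = 0\<close> and pieces may be arbitrarily
short.\<close>

lemma chunks_exist:
  assumes h: "0 < h" and "w \<in> words S \<tau>" "\<forall>p\<in>set w. fst p \<le> 2 * h"
  shows "\<exists>v vs. concat (v # vs) = w \<and> (\<forall>u\<in>set (v # vs). duration u \<le> 3 * h)
    \<and> real (length vs) * h \<le> (\<Sum>u\<leftarrow>vs. duration u)"
  using assms(2,3)
proof (induction w)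
  case Nil
  show ?case using h by (intro exI[of _ "[]"]) auto
next
  case (Cons p w)
  then obtain v vs where vs: "concat (v # vs) = w" "\<forall>u\<in>set (v # vs). duration u \<le> 3 * h"
    "real (length vs) * h \<le> (\<Sum>u\<leftarrow>vs. duration u)" by auto
  have p: "fst p \<le> 2 * h" using Cons.prems by simp
  show ?case
  proof (cases "h \<le> duration v")
    case True
    show ?thesis
      by (rule exI[of _ "[p]"], rule exI[of _ "v # vs"])
        (use vs p h True in \<open>simp add: algebra_simps\<close>)
  next
    case False
    show ?thesis
      by (rule exI[of _ "p # v"], rule exI[of _ vs]) (use vs p h False in simp)
  qed
qed

lemma norm_flow_vec_le:
  fixes w :: "'n::finite word"
  assumes K: "\<And>a x. a \<in> S \<Longrightarrow> norm (a *v x) \<le> K * norm x" and w: "w \<in> words S \<tau>" and \<tau>: "0 \<le> \<tau>"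
  shows "norm (flow w *v x) \<le> exp (K * duration w) * norm x"
  using w
proof (induction w)
  case (Cons p w)
  have "norm (flow (p # w) *v x) = norm (mexp (snd p) (fst p) *v (flow w *v x))"
    by (simp add: matrix_vector_mul_assoc)
  also have "\<dots> \<le> exp (K * fst p) * norm (flow w *v x)"
    by (rule norm_mexp_vec_le) (use K Cons.prems \<tau> in auto)
  also have "\<dots> \<le> exp (K * fst p) * (exp (K * duration w) * norm x)"
    using Cons by (intro mult_left_mono) auto
  finally show ?case by (simp add: exp_add distrib_left mult.assoc)
qed simp

lemma abs_trace_le:
  fixes A :: "real^'n^'n"
  assumes "\<And>z. poly (charpoly A) z = 0 \<Longrightarrow> norm z \<le> r"
  shows "\<bar>trace A\<bar> \<le> real CARD('n) * r"
proof -
  obtain zs where zs: "length zs = CARD('n)" "charpoly A = (\<Prod>z\<leftarrow>zs. [:- z, 1:])"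
    "of_real (trace (mpow A 1)) = (\<Sum>z\<leftarrow>zs. z ^ 1)"
    using charpoly_eigenvalues[of A] by metis
  have "norm z \<le> r" if "z \<in> set zs" for z
    using that by (intro assms) (auto simp: zs(2) poly_linear_factors_root prod_list_zero_iff)
  then have "norm (\<Sum>z\<leftarrow>zs. z) \<le> real (length zs) * r"
  proof (induction zs)
    case (Cons z zs)
    have "norm (z + (\<Sum>z\<leftarrow>zs. z)) \<le> norm z + norm (\<Sum>z\<leftarrow>zs. z)" by (rule norm_triangle_ineq)
    also have "\<dots> \<le> r + real (length zs) * r" using Cons by (intro add_mono) auto
    finally show ?case by (simp add: algebra_simps)
  qed simp
  moreover have "\<bar>trace A\<bar> = norm (\<Sum>z\<leftarrow>zs. z)"
  proof -
    have "(\<Sum>z\<leftarrow>zs. z) = complex_of_real (trace A)" using zs(3) by simp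
    then show ?thesis by simp
  qed
  ultimately show ?thesis using zs(1) by simp
qed

text \<open>Rescaled so that the bound \<open>exp (\<mu> T)\<close> on spectral radii over a time \<open>T\<close> becomes the bound \<open>1\<close>.\<close>

definition normalised_flow :: "real \<Rightarrow> 'n::finite word \<Rightarrow> real^'n^'n" where
  "normalised_flow \<mu> w = exp (- \<mu> * duration w) *\<^sub>R flow w"

lemma matrix_mult_scaleR_right: "A ** (c *\<^sub>R B) = c *\<^sub>R (A ** B)" for A :: "real^'n^'n"
  by (simp add: matrix_matrix_mult_def Finite_Cartesian_Product.vec_eq_iff sum_distrib_left mult_ac)

lemma mprod_normalised_flow: "mprod (map (normalised_flow \<mu>) ws) = normalised_flow \<mu> (concat ws)"
proof (induction ws)
  case (Cons w ws)
  have "exp (- \<mu> * duration (w @ concat ws)) = exp (- \<mu> * duration w) * exp (- \<mu> * duration (concat ws))"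
    by (simp add: exp_add[symmetric] algebra_simps)
  then show ?case using Cons
    by (simp add: normalised_flow_def flow_append matrix_mult_scaleR_left matrix_mult_scaleR_right)
qed (simp add: normalised_flow_def)

text \<open>The chunks of a word range over a bounded set of matrices, and their number is at most the duration
plus one; so polynomial growth in the number of factors is polynomial growth in time.\<close>

lemma flow_growth:
  fixes S :: "(real^'n^'n) set"
  assumes K: "\<And>a x. a \<in> S \<Longrightarrow> norm (a *v x) \<le> K * norm x" "0 \<le> K" and \<tau>: "0 \<le> \<tau>"
    and spec: "\<And>w z. w \<in> words S \<tau> \<Longrightarrow> poly (charpoly (flow w)) z = 0 \<Longrightarrow> norm z \<le> exp (\<mu> * duration w)"
  obtains C k where "0 \<le> C" "\<And>w x. w \<in> words S \<tau> \<Longrightarrow>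
    norm (flow w *v x) \<le> C * (2 + duration w) ^ k * exp (\<mu> * duration w) * norm x"
proof -
  define h where "h = \<tau> + 1"
  have h: "0 < h" "\<tau> \<le> h" "1 \<le> h" using \<tau> by (auto simp: h_def)
  let ?N = "normalised_flow \<mu>"
  define \<Sigma> where "\<Sigma> = ?N ` {v \<in> words S \<tau>. duration v \<le> 3 * h}"
  define b where "b = exp (\<bar>\<mu>\<bar> * (3 * h)) * exp (K * (3 * h))"
  have lift: "\<exists>ws. Ms = map ?N ws \<and> concat ws \<in> words S \<tau>" if "Ms \<in> lists \<Sigma>" for Ms
    using that
  proof (induction Ms)
    case Nil
    show ?case by (rule exI[of _ "[]"]) simp
  next
    case (Cons M Ms)
    then obtain ws v where "Ms = map ?N ws" "concat ws \<in> words S \<tau>" "M = ?N v" "v \<in> words S \<tau>"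
      unfolding \<Sigma>_def by auto
    then show ?case by (intro exI[of _ "v # ws"]) simp
  qed
  have tr: "\<bar>trace (mprod Ms)\<bar> \<le> real CARD('n)" if "Ms \<in> lists \<Sigma>" for Ms
  proof -
    obtain ws where ws: "Ms = map ?N ws" "concat ws \<in> words S \<tau>" using lift[OF \<open>Ms \<in> lists \<Sigma>\<close>] by blast
    let ?w = "concat ws"
    have "\<bar>trace (flow ?w)\<bar> \<le> real CARD('n) * exp (\<mu> * duration ?w)"
      by (rule abs_trace_le) (rule spec[OF ws(2)])
    then have "exp (- \<mu> * duration ?w) * \<bar>trace (flow ?w)\<bar>
        \<le> exp (- \<mu> * duration ?w) * (real CARD('n) * exp (\<mu> * duration ?w))"
      by (intro mult_left_mono) auto
    also have "\<dots> = real CARD('n)" by (simp add: exp_minus)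
    finally have "exp (- \<mu> * duration ?w) * \<bar>trace (flow ?w)\<bar> \<le> real CARD('n)" .
    moreover have "trace (mprod Ms) = exp (- \<mu> * duration ?w) * trace (flow ?w)"
      unfolding ws(1) mprod_normalised_flow normalised_flow_def by (simp add: trace_def sum_distrib_left)
    ultimately show ?thesis by (simp add: abs_mult)
  qed
  have nb: "norm (M *v x) \<le> b * norm x" if M: "M \<in> \<Sigma>" for M x
  proof -
    obtain v where v: "v \<in> words S \<tau>" "duration v \<le> 3 * h" "M = ?N v" using M unfolding \<Sigma>_def by blast
    have d: "0 \<le> duration v" using duration_nonneg[OF nonneg_wordI[OF v(1) \<tau>]] .
    have "norm (M *v x) = exp (- \<mu> * duration v) * norm (flow v *v x)"
      by (simp add: v(3) normalised_flow_def scaleR_matrix_vector_assoc[symmetric])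
    also have "\<dots> \<le> exp (\<bar>\<mu>\<bar> * (3 * h)) * (exp (K * (3 * h)) * norm x)"
    proof (rule mult_mono)
      have "- \<mu> * duration v \<le> \<bar>\<mu>\<bar> * duration v" using d by (intro mult_right_mono) auto
      also have "\<dots> \<le> \<bar>\<mu>\<bar> * (3 * h)" using v(2) by (intro mult_left_mono) auto
      finally show "exp (- \<mu> * duration v) \<le> exp (\<bar>\<mu>\<bar> * (3 * h))" by simp
      have "norm (flow v *v x) \<le> exp (K * duration v) * norm x" by (rule norm_flow_vec_le[OF K(1) v(1) \<tau>])
      also have "\<dots> \<le> exp (K * (3 * h)) * norm x"
        using v(2) K(2) by (intro mult_right_mono) (auto intro: mult_left_mono)
      finally show "norm (flow v *v x) \<le> exp (K * (3 * h)) * norm x" .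
    qed auto
    finally show ?thesis by (simp add: b_def mult.assoc)
  qed
  have b0: "0 \<le> b" by (simp add: b_def)
  obtain C k where C: "0 \<le> C" "\<And>Ms x. Ms \<in> lists \<Sigma> \<Longrightarrow>
      norm (mprod Ms *v x) \<le> C * (1 + real (length Ms)) ^ k * norm x"
    using polynomial_growth_of_products[OF tr nb b0] by blast
  have "norm (flow w *v x) \<le> C * (2 + duration w) ^ k * exp (\<mu> * duration w) * norm x"
    if w: "w \<in> words S \<tau>" for w x
  proof -
    obtain w' where w': "w' \<in> words S \<tau>" "flow w' = flow w" "duration w' = duration w"
      "\<forall>p\<in>set w'. fst p \<le> 2 * h"
      using split_long_pieces[OF h(1,2) w] by blast
    obtain v vs where vs: "concat (v # vs) = w'" "\<forall>u\<in>set (v # vs). duration u \<le> 3 * h"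
      "real (length vs) * h \<le> (\<Sum>u\<leftarrow>vs. duration u)"
      using chunks_exist[OF h(1) w'(1,4)] by blast
    have inw: "u \<in> words S \<tau>" if "u \<in> set (v # vs)" for u
      using w'(1) that unfolding vs(1)[symmetric] words_def by auto
    have "real (length vs) \<le> duration w"
    proof -
      have "real (length vs) * 1 \<le> real (length vs) * h" using h(3) by (intro mult_left_mono) auto
      also have "\<dots> \<le> (\<Sum>u\<leftarrow>vs. duration u)" by (rule vs(3))
      also have "\<dots> = duration (concat vs)" by (induction vs) auto
      also have "\<dots> \<le> duration w'"
        using duration_nonneg[OF nonneg_wordI[OF inw \<tau>], of v] unfolding vs(1)[symmetric] by simp
      finally show ?thesis using w'(3) by simp
    qed
    then have len: "1 + real (length (map ?N (v # vs))) \<le> 2 + duration w" by simp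
    have "map ?N (v # vs) \<in> lists \<Sigma>" using inw vs(2) unfolding \<Sigma>_def by auto
    then have "norm (mprod (map ?N (v # vs)) *v x) \<le> C * (1 + real (length (map ?N (v # vs)))) ^ k * norm x"
      by (rule C(2))
    also have "\<dots> \<le> C * (2 + duration w) ^ k * norm x"
      using C(1) len by (intro mult_right_mono mult_left_mono power_mono) auto
    also have "mprod (map ?N (v # vs)) = exp (- \<mu> * duration w) *\<^sub>R flow w"
      unfolding mprod_normalised_flow vs(1) normalised_flow_def w'(2,3) ..
    finally have "exp (- \<mu> * duration w) * norm (flow w *v x) \<le> C * (2 + duration w) ^ k * norm x"
      by (simp add: scaleR_matrix_vector_assoc[symmetric])
    then have "exp (\<mu> * duration w) * (exp (- \<mu> * duration w) * norm (flow w *v x))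
        \<le> exp (\<mu> * duration w) * (C * (2 + duration w) ^ k * norm x)"
      by (intro mult_left_mono) auto
    moreover have "exp (\<mu> * duration w) * (exp (- \<mu> * duration w) * norm (flow w *v x)) = norm (flow w *v x)"
      by (simp add: exp_minus)
    ultimately have "norm (flow w *v x) \<le> exp (\<mu> * duration w) * (C * (2 + duration w) ^ k * norm x)"
      by (simp only:)
    then show ?thesis by (simp only: mult_ac)
  qed
  with that C(1) show ?thesis by blast
qed

lemma flow_of_zero_duration: "nonneg_word w \<Longrightarrow> duration w = 0 \<Longrightarrow> flow w = mat 1"
proof (induction w)
  case (Cons p w)
  have "0 \<le> duration w" "0 \<le> fst p" using Cons.prems(1) by (auto intro: duration_nonneg)
  then have "fst p = 0" "duration w = 0" using Cons.prems(2) by auto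
  then show ?case using Cons by simp
qed simp

lemma eigenvalue_of_zero_duration:
  assumes "nonneg_word w" "duration w = 0" "poly (charpoly (flow w)) z = 0"
  shows "z = 1"
proof -
  obtain v where "v \<noteq> 0" "cmat (flow w) *v v = z *s v" using assms(3) unfolding charpoly_root_iff by blast
  then have v: "v \<noteq> 0" "v = z *s v" using flow_of_zero_duration[OF assms(1,2)] by (simp_all add: cmat_one)
  obtain i where i: "v $ i \<noteq> 0" using v(1) by (auto simp: Finite_Cartesian_Product.vec_eq_iff)
  have "v $ i = z * v $ i" using v(2) by (metis vector_smult_component)
  then show ?thesis using i by simp
qed

text \<open>The polynomial factor, and the factor lost by truncating a signal to a word, disappear in the limit.\<close>

lemma uniform_rate_le:
  fixes S :: "(real^'n^'n) set"
  assumes S: "S \<noteq> {}" "bounded S" and \<tau>: "0 \<le> \<tau>"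
    and spec: "\<And>w z. w \<in> words S \<tau> \<Longrightarrow> poly (charpoly (flow w)) z = 0 \<Longrightarrow> norm z \<le> exp (\<mu> * duration w)"
  shows "uniform_rate \<tau> S \<le> ereal \<mu>"
proof -
  obtain K where K0: "0 < K" "\<And>a. a \<in> S \<Longrightarrow> norm a \<le> K" using S(2) unfolding bounded_pos by blast
  have K: "norm (a *v x) \<le> K * norm x" if "a \<in> S" for a x
    using norm_matrix_vector_le[of a x] mult_right_mono[OF K0(2)[OF that], of "norm x"] by simp
  obtain C k where C: "0 \<le> C" "\<And>w x. w \<in> words S \<tau> \<Longrightarrow>
    norm (flow w *v x) \<le> C * (2 + duration w) ^ k * exp (\<mu> * duration w) * norm x"
    using flow_growth[OF K _ \<tau> spec] K0(1) by (metis less_imp_le)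
  define C' where "C' = (C + 1) * exp (K * \<tau>) * exp (\<bar>\<mu>\<bar> * \<tau>)"
  have C': "0 < C'" using C(1) by (simp add: C'_def)
  define g where "g t = (ln C' + real k * ln (2 + t) + \<mu> * t) / t" for t
  have bound: "ln (onorm ((*v) (fundamental_matrix A t))) / t \<le> g t"
    if A: "A \<in> signals S \<tau>" and t: "0 < t" for A t
  proof -
    let ?F = "fundamental_matrix A t"
    obtain w where w: "w \<in> words S \<tau>" "t < duration w" "follows A w"
      using signals_word_beyond[OF S(1) \<tau> A] by blast
    have Fw: "?F = traj w t"
      by (rule fundamental_matrix_traj[OF S(1) \<tau> A nonneg_wordI[OF w(1) \<tau>] w(3)]) (use t w(2) in auto)
    obtain v a r where v: "v \<in> words S \<tau>" "a \<in> S" "0 \<le> r" "r \<le> \<tau>" "duration v + r = t"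
      "traj w t = mexp a r ** flow v"
      using traj_truncate[OF w(1) S(1) \<tau>, of t] t w(2) by auto
    have d0: "0 \<le> duration v" using duration_nonneg[OF nonneg_wordI[OF v(1) \<tau>]] .
    have le: "norm (?F *v x) \<le> (C' * (2 + t) ^ k * exp (\<mu> * t)) * norm x" for x
    proof -
      have "norm (?F *v x) = norm (mexp a r *v (flow v *v x))"
        by (simp add: Fw v(6) matrix_vector_mul_assoc)
      also have "\<dots> \<le> exp (K * r) * norm (flow v *v x)" by (rule norm_mexp_vec_le[OF K[OF v(2)] v(3)])
      also have "\<dots> \<le> exp (K * \<tau>) * ((C + 1) * (2 + t) ^ k * (exp (\<bar>\<mu>\<bar> * \<tau>) * exp (\<mu> * t)) * norm x)"
      proof (rule mult_mono)
        show "exp (K * r) \<le> exp (K * \<tau>)" using K0(1) v(4) by simp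
        have e: "exp (\<mu> * duration v) \<le> exp (\<bar>\<mu>\<bar> * \<tau>) * exp (\<mu> * t)"
        proof -
          have "- \<mu> * r \<le> \<bar>\<mu>\<bar> * r" using v(3) by (intro mult_right_mono) auto
          also have "\<dots> \<le> \<bar>\<mu>\<bar> * \<tau>" using v(4) by (intro mult_left_mono) auto
          finally have "\<mu> * duration v \<le> \<bar>\<mu>\<bar> * \<tau> + \<mu> * t" unfolding v(5)[symmetric] by (simp add: algebra_simps)
          then show ?thesis by (simp add: exp_add[symmetric])
        qed
        have "C * (2 + duration v) ^ k * exp (\<mu> * duration v)
            \<le> (C + 1) * (2 + t) ^ k * (exp (\<bar>\<mu>\<bar> * \<tau>) * exp (\<mu> * t))"
          using C(1) d0 v(3,5) by (intro mult_mono e power_mono) auto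
        then have "C * (2 + duration v) ^ k * exp (\<mu> * duration v) * norm x
            \<le> (C + 1) * (2 + t) ^ k * (exp (\<bar>\<mu>\<bar> * \<tau>) * exp (\<mu> * t)) * norm x"
          by (intro mult_right_mono) auto
        then show "norm (flow v *v x) \<le> (C + 1) * (2 + t) ^ k * (exp (\<bar>\<mu>\<bar> * \<tau>) * exp (\<mu> * t)) * norm x"
          using C(2)[OF v(1), of x] by linarith
      qed auto
      also have "\<dots> = (C' * (2 + t) ^ k * exp (\<mu> * t)) * norm x" by (simp add: C'_def mult_ac)
      finally show ?thesis .
    qed
    have on: "onorm ((*v) ?F) \<le> C' * (2 + t) ^ k * exp (\<mu> * t)"
      using le by (rule onorm_le)
    have pos: "0 < onorm ((*v) ?F)"
    proof -
      have "(axis undefined 1 :: real^'n) \<noteq> 0" by (simp add: axis_eq_0_iff)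
      from fundamental_matrix_nonzero[OF S(1) \<tau> A less_imp_le[OF t] this]
      show ?thesis using onorm_pos_lt[OF matrix_vector_mul_bounded_linear[of ?F]] by blast
    qed
    have "ln (onorm ((*v) ?F)) \<le> ln (C' * (2 + t) ^ k * exp (\<mu> * t))"
      using on pos by simp
    also have "\<dots> = ln C' + real k * ln (2 + t) + \<mu> * t"
      using C' t by (simp add: ln_mult ln_realpow)
    finally show ?thesis using t by (simp add: g_def divide_right_mono)
  qed
  have "uniform_rate \<tau> S \<le> Limsup at_top (\<lambda>t. ereal (g t))"
    unfolding uniform_rate_def
  proof (rule Limsup_mono)
    show "\<forall>\<^sub>F t in at_top. (SUP A\<in>signals S \<tau>. ereal (ln (onorm ((*v) (fundamental_matrix A t))) / t)) \<le> ereal (g t)"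
      using eventually_gt_at_top[of 0] by eventually_elim (auto intro!: SUP_least bound)
  qed
  also have "\<dots> = ereal \<mu>"
  proof (rule lim_imp_Limsup)
    have "((\<lambda>t. ln C' * (1 / t) + real k * (ln (2 + t) / t) + \<mu>) \<longlongrightarrow> ln C' * 0 + real k * 0 + \<mu>) at_top"
    proof (intro tendsto_intros)
      show "((\<lambda>t::real. 1 / t) \<longlongrightarrow> 0) at_top" by real_asymp
      show "((\<lambda>t::real. ln (2 + t) / t) \<longlongrightarrow> 0) at_top" by real_asymp
    qed
    moreover have "\<forall>\<^sub>F t in at_top. ln C' * (1 / t) + real k * (ln (2 + t) / t) + \<mu> = g t"
      using eventually_gt_at_top[of 0] by eventually_elim (simp add: g_def add_divide_distrib)
    ultimately have "(g \<longlongrightarrow> ln C' * 0 + real k * 0 + \<mu>) at_top"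
      by (rule Lim_transform_eventually)
    then show "((\<lambda>t. ereal (g t)) \<longlongrightarrow> ereal \<mu>) at_top" by simp
  qed simp
  finally show ?thesis .
qed

section \<open>The two rates\<close>

lemma periodic_rate_le_uniform_rate:
  fixes S :: "(real^'n^'n) set"
  assumes S: "S \<noteq> {}" and \<tau>: "0 \<le> \<tau>"
  shows "periodic_rate \<tau> S \<le> uniform_rate \<tau> S"
  unfolding periodic_rate_def
proof (rule SUP_least, clarify)
  fix A :: "real \<Rightarrow> real^'n^'n" and x assume "(A, x) \<in> periodic_pairs \<tau> S"
  then have A: "A \<in> signals S \<tau>" and x: "x \<noteq> 0" by (auto simp: periodic_pairs_def)
  let ?f = "\<lambda>t. ereal (ln (norm (fundamental_matrix A t *v x)) / t)"
  show "Limsup at_top ?f \<le> uniform_rate \<tau> S"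
  proof (rule ccontr)
    assume "\<not> ?thesis"
    then obtain \<mu> where \<mu>: "uniform_rate \<tau> S < ereal \<mu>" "ereal \<mu> < Limsup at_top ?f"
      using ereal_dense2 by (meson not_le)
    have "\<forall>\<^sub>F t in at_top. (SUP A\<in>signals S \<tau>. ereal (ln (onorm ((*v) (fundamental_matrix A t))) / t)) < ereal \<mu>"
      using \<mu>(1) unfolding uniform_rate_def by (rule Limsup_lessD)
    then have "\<forall>\<^sub>F t in at_top. ?f t \<le> ereal (\<mu> + ln (norm x) * (1 / t))"
      using eventually_gt_at_top[of 0]
    proof eventually_elim
      case (elim t)
      let ?F = "fundamental_matrix A t"
      have "ereal (ln (onorm ((*v) ?F)) / t)
          \<le> (SUP A\<in>signals S \<tau>. ereal (ln (onorm ((*v) (fundamental_matrix A t))) / t))"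
        using A by (rule SUP_upper)
      also note elim(1)
      finally have "ereal (ln (onorm ((*v) ?F)) / t) < ereal \<mu>" .
      then have l: "ln (onorm ((*v) ?F)) / t < \<mu>" by simp
      have nz: "0 < norm (?F *v x)" using fundamental_matrix_nonzero[OF S \<tau> A _ x, of t] elim(2) by simp
      have bl: "bounded_linear ((*v) ?F)" by simp
      have le: "norm (?F *v x) \<le> onorm ((*v) ?F) * norm x" by (rule onorm[OF bl])
      have pos: "0 < onorm ((*v) ?F)" using onorm_pos_lt[OF bl] nz by (metis zero_less_norm_iff)
      have "ln (norm (?F *v x)) \<le> ln (onorm ((*v) ?F) * norm x)"
        using ln_le_cancel_iff[OF nz less_le_trans[OF nz le]] le by blast
      also have "\<dots> = ln (onorm ((*v) ?F)) + ln (norm x)" using pos x by (simp add: ln_mult)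
      finally have "ln (norm (?F *v x)) / t \<le> (ln (onorm ((*v) ?F)) + ln (norm x)) / t"
        using elim(2) by (intro divide_right_mono) auto
      then show ?case using l by (simp add: add_divide_distrib)
    qed
    then have "Limsup at_top ?f \<le> Limsup at_top (\<lambda>t. ereal (\<mu> + ln (norm x) * (1 / t)))"
      by (rule Limsup_mono)
    also have "\<dots> = ereal \<mu>"
    proof (rule lim_imp_Limsup)
      have "((\<lambda>t. \<mu> + ln (norm x) * (1 / t)) \<longlongrightarrow> \<mu> + ln (norm x) * 0) at_top"
      proof (intro tendsto_intros)
        show "((\<lambda>t::real. 1 / t) \<longlongrightarrow> 0) at_top" by real_asymp
      qed
      then show "((\<lambda>t. ereal (\<mu> + ln (norm x) * (1 / t))) \<longlongrightarrow> ereal \<mu>) at_top" by simp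
    qed simp
    finally show False using \<mu>(2) by simp
  qed
qed

text \<open>Stretch the word so that some large eigenvalue has a real power; the corresponding repetition of the
stretched word has a real eigenvector, which gives a periodic pair.\<close>

lemma periodic_rate_ge:
  fixes S :: "(real^'n^'n) set"
  assumes S: "S \<noteq> {}" and \<tau>: "0 \<le> \<tau>" and w: "w \<in> words S \<tau>"
    and z: "poly (charpoly (flow w)) z = 0" "exp (\<mu> * duration w) < norm z"
  shows "ereal \<mu> \<le> periodic_rate \<tau> S"
proof -
  have nn: "nonneg_word w" by (rule nonneg_wordI[OF w \<tau>])
  have "duration w \<noteq> 0" using eigenvalue_of_zero_duration[OF nn _ z(1)] z(2) by auto
  then have pos: "0 < duration w" using duration_nonneg[OF nn] by simp
  obtain s z' k where s: "1 \<le> s" "poly (charpoly (flow (scale_word s w))) z' = 0"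
    "exp (\<mu> * (s * duration w)) < norm z'" "0 < k" "z' ^ k = of_real (norm z' ^ k)"
    using eigenvalue_with_real_power[OF z] by metis
  define v where "v = repeat_word k (scale_word s w)"
  define r where "r = norm z' ^ k"
  have v: "v \<in> words S \<tau>"
    unfolding v_def by (intro repeat_word_in scale_word_in_words w s(1) \<tau>)
  have dv: "duration v = real k * (s * duration w)"
    by (simp add: v_def duration_repeat_word duration_scale_word)
  have posv: "0 < duration v" unfolding dv using pos s(1,4) by simp
  obtain x where x: "x \<noteq> 0" "mpow (flow (scale_word s w)) k *v x = r *\<^sub>R x"
    using real_eigenvector_of_power[OF s(2), of k r] s(5) unfolding r_def by metis
  then have fx: "flow v *v x = r *\<^sub>R x" by (simp add: v_def flow_repeat_word)
  have r: "exp (\<mu> * duration v) < r"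
  proof -
    have "exp (\<mu> * (s * duration w)) ^ k < norm z' ^ k" using s(3,4) by (intro power_strict_mono) auto
    moreover have "exp (\<mu> * duration v) = exp (\<mu> * (s * duration w)) ^ k"
      unfolding dv exp_of_nat_mult[symmetric] by (simp add: mult_ac)
    ultimately show ?thesis by (simp add: r_def)
  qed
  have r0: "0 < r" using r exp_gt_zero order.strict_trans by blast
  have lnr: "\<mu> * duration v < ln r" using r r0 by (metis exp_less_cancel_iff exp_ln)
  let ?A = "periodic_signal v"
  note pp = periodic_pair_of_real_eigenvector[OF S v \<tau> posv x(1) fx]
  let ?f = "\<lambda>t. ereal (ln (norm (fundamental_matrix ?A t *v x)) / t)"
  have "ereal \<mu> \<le> Limsup at_top ?f"
  proof (rule ccontr)
    assume "\<not> ?thesis"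
    then have "Limsup at_top ?f < ereal \<mu>" by simp
    then have "\<forall>\<^sub>F t in at_top. ?f t < ereal \<mu>" by (rule Limsup_lessD)
    then obtain R where R: "\<And>t. R \<le> t \<Longrightarrow> ?f t < ereal \<mu>" unfolding eventually_at_top_linorder by blast
    obtain n1 where n1: "R < real n1 * duration v" using reals_Archimedean3[OF posv] by blast
    have \<delta>: "0 < ln r - \<mu> * duration v" using lnr by simp
    obtain n2 where n2: "- ln (norm x) < real n2 * (ln r - \<mu> * duration v)"
      using reals_Archimedean3[OF \<delta>] by blast
    \<comment> \<open>late enough for the assumed bound, and for the surplus over \<open>\<mu>\<close> to absorb the norm of \<open>x\<close>\<close>
    define n where "n = Suc (max n1 n2)"
    let ?t = "real n * duration v"
    have n: "0 < n" "n1 \<le> n" "n2 \<le> n" by (auto simp: n_def)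
    have t0: "0 < ?t" using n(1) posv by simp
    have "real n1 * duration v \<le> ?t" using n(2) posv by (intro mult_right_mono) auto
    then have "?f ?t < ereal \<mu>" using n1 by (intro R) simp
    then have "ln (norm (r ^ n *\<^sub>R x)) / ?t < \<mu>" unfolding pp(2) by simp
    moreover have "ln (norm (r ^ n *\<^sub>R x)) = real n * ln r + ln (norm x)"
      using r0 x(1) by (simp add: ln_mult ln_realpow)
    ultimately have "real n * ln r + ln (norm x) < \<mu> * ?t" using t0 by (simp add: divide_less_eq)
    moreover have "real n2 * (ln r - \<mu> * duration v) \<le> real n * (ln r - \<mu> * duration v)"
      using n(3) \<delta> by (intro mult_right_mono) auto
    ultimately show False using n2 by (simp add: algebra_simps)
  qed
  also have "\<dots> \<le> periodic_rate \<tau> S"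
    unfolding periodic_rate_def by (rule SUP_upper2[OF pp(1)]) simp
  finally show ?thesis .
qed

theorem theorem29:
  fixes S :: "(real^'n^'n) set" and \<tau> :: real
  assumes "S \<noteq> {}" and "bounded S" and "0 \<le> \<tau>"
  shows "periodic_rate \<tau> S = uniform_rate \<tau> S"
proof (rule antisym)
  show "periodic_rate \<tau> S \<le> uniform_rate \<tau> S"
    by (rule periodic_rate_le_uniform_rate[OF assms(1,3)])
  show "uniform_rate \<tau> S \<le> periodic_rate \<tau> S"
  proof (rule ccontr)
    assume "\<not> ?thesis"
    then obtain \<mu> where \<mu>: "periodic_rate \<tau> S < ereal \<mu>" "ereal \<mu> < uniform_rate \<tau> S"
      using ereal_dense2 by (meson not_le)
    have "norm z \<le> exp (\<mu> * duration w)" if "w \<in> words S \<tau>" "poly (charpoly (flow w)) z = 0" for w z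
      using periodic_rate_ge[OF assms(1,3) that, of \<mu>] \<mu>(1) by (meson leD leI)
    then have "uniform_rate \<tau> S \<le> ereal \<mu>" by (rule uniform_rate_le[OF assms])
    then show False using \<mu>(2) by simp
  qed
qed

end
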